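(* Let $M$ be a manifold-with-boundary equipped with a free circle action near its boundary, and let $M_{\mathrm{red}}=(\partial M)/S^1$. Let $\beta$ be a symplectic two-form on $M$ that is basic on $\partial M$ and invariant near $\partial M$. Then $\beta_{\mathrm{red}}$ is a symplectic two-form on $M_{\mathrm{red}}$.
   Context: Manifolds, with or without boundary, are smooth, Hausdorff and second countable. "A free circle action near the boundary" means a smooth free action of $S^1$ on an open neighbourhood $U_M$ of the boundary $\partial M$ in $M$; necessarily $\partial M$ is $S^1$-invariant. $M_{\mathrm{red}} := (\partial M)/S^1$ has the unique manifold structure for which $\partial M\to M_{\mathrm{red}}$ is a principal $S^1$-bundle. "$\beta$ is basic on $\partial M$ and invariant near $\partial M$" means: the pullback of $\beta$ to $\partial M$ is $S^1$-basic (i.e. $S^1$-invariant and annihilated by contraction with the vector field generating the circle action), and the restriction of $\beta$ to some $S^1$-invariant neighbourhood of $\partial M$ in $U_M$ is $S^1$-invariant. For such $\beta$, $\beta_{\mathrm{red}}$ is the unique differential form on $M_{\mathrm{red}}$ whose pullback to $\partial M$ under the quotient map coincides with the pullback of $\beta$ to $\partial M$. *)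

theory Defs
  imports "HOL-Analysis.Analysis"
begin

section \<open>Smooth maps on subsets of Euclidean spaces\<close>

fun Ck_on :: "nat \<Rightarrow> 'e::euclidean_space set \<Rightarrow> ('e \<Rightarrow> 'f::real_normed_vector) \<Rightarrow> bool" where
  "Ck_on 0 W g \<longleftrightarrow> continuous_on W g"
| "Ck_on (Suc k) W g \<longleftrightarrow> (\<forall>x\<in>W. g differentiable (at x)) \<and>
     (\<forall>v. Ck_on k W (\<lambda>x. frechet_derivative g (at x) v))"

text \<open>On an arbitrary set \<open>A\<close>, smooth means: locally the restriction of a smooth map defined on
  an open subset of the ambient space.  This is applied to relatively open subsets of linear
  subspaces and of half-spaces of linear subspaces.\<close>

definition smooth_on :: "'e::euclidean_space set \<Rightarrow> ('e \<Rightarrow> 'f::real_normed_vector) \<Rightarrow> bool" where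
  "smooth_on A f \<longleftrightarrow> (\<forall>x\<in>A. \<exists>W g. open W \<and> x \<in> W \<and> (\<forall>k. Ck_on k W g) \<and> (\<forall>y\<in>A \<inter> W. g y = f y))"


section \<open>Manifolds with boundary\<close>

type_synonym ('m, 'e) chart = "'m set \<times> ('m \<Rightarrow> 'e)"

text \<open>The charts take values in \<open>{x \<in> model. 0 \<le> x \<bullet> normal}\<close>, where \<open>model\<close> is a linear subspace of
  a Euclidean space and \<open>normal \<in> model\<close>.  For \<open>normal \<noteq> 0\<close> this is a half-space of \<open>model\<close>; for
  \<open>normal = 0\<close> it is all of \<open>model\<close> (manifolds without boundary).  The dimension of the manifold
  is \<open>dim model\<close>, which may be \<open>0\<close>.  The atlas is not required to be maximal.\<close>

record ('m, 'e) mfd =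
  mtop :: "'m topology"
  atlas :: "('m, 'e) chart set"
  model :: "'e set"
  normal :: 'e

definition pts :: "('m, 'e::euclidean_space) mfd \<Rightarrow> 'm set" where
  "pts M = topspace (mtop M)"

definition half_model :: "('m, 'e::euclidean_space) mfd \<Rightarrow> 'e set" where
  "half_model M = {x \<in> model M. 0 \<le> x \<bullet> normal M}"

definition charts_at :: "('m, 'e::euclidean_space) mfd \<Rightarrow> 'm \<Rightarrow> ('m, 'e) chart set" where
  "charts_at M p = {c \<in> atlas M. p \<in> fst c}"

definition cinv :: "('m, 'e) chart \<Rightarrow> 'e \<Rightarrow> 'm" where
  "cinv c = inv_into (fst c) (snd c)"

definition manifold :: "('m, 'e::euclidean_space) mfd \<Rightarrow> bool" where
  "manifold M \<longleftrightarrow>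
     Hausdorff_space (mtop M) \<and> second_countable (mtop M) \<and>
     subspace (model M) \<and> normal M \<in> model M \<and>
     (\<Union>c\<in>atlas M. fst c) = pts M \<and>
     (\<forall>c\<in>atlas M. openin (mtop M) (fst c) \<and>
        openin (top_of_set (half_model M)) (snd c ` fst c) \<and>
        homeomorphic_map (subtopology (mtop M) (fst c)) (top_of_set (snd c ` fst c)) (snd c)) \<and>
     (\<forall>c\<in>atlas M. \<forall>d\<in>atlas M. smooth_on (snd c ` (fst c \<inter> fst d)) (snd d \<circ> cinv c))"

definition boundary :: "('m, 'e::euclidean_space) mfd \<Rightarrow> 'm set" where
  "boundary M = {p \<in> pts M. normal M \<noteq> 0 \<and> (\<exists>c\<in>charts_at M p. snd c p \<bullet> normal M = 0)}"

definition open_submfd :: "('m, 'e::euclidean_space) mfd \<Rightarrow> 'm set \<Rightarrow> ('m, 'e) mfd" where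
  "open_submfd M W = \<lparr>mtop = subtopology (mtop M) W,
     atlas = (\<lambda>c. (fst c \<inter> W, snd c)) ` atlas M, model = model M, normal = normal M\<rparr>"

definition boundary_mfd :: "('m, 'e::euclidean_space) mfd \<Rightarrow> ('m, 'e) mfd" where
  "boundary_mfd M = \<lparr>mtop = subtopology (mtop M) (boundary M),
     atlas = (\<lambda>c. (fst c \<inter> boundary M, snd c)) ` atlas M,
     model = {x \<in> model M. x \<bullet> normal M = 0}, normal = 0\<rparr>"

text \<open>Only meaningful when at least one factor has \<open>normal = 0\<close> (otherwise corners appear).\<close>

definition prod_mfd ::
  "('m, 'e::euclidean_space) mfd \<Rightarrow> ('n, 'f::euclidean_space) mfd \<Rightarrow> ('m \<times> 'n, 'e \<times> 'f) mfd" where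
  "prod_mfd M N = \<lparr>mtop = prod_topology (mtop M) (mtop N),
     atlas = {(fst c \<times> fst d, map_prod (snd c) (snd d)) |c d. c \<in> atlas M \<and> d \<in> atlas N},
     model = model M \<times> model N, normal = (normal M, normal N)\<rparr>"

abbreviation S1 :: "complex set" where
  "S1 \<equiv> sphere 0 1"

text \<open>The charts of the circle are the angle functions with values in an open interval of
  length \<open>2 * pi\<close>.\<close>

definition circle :: "(complex, real) mfd" where
  "circle = \<lparr>mtop = top_of_set S1,
     atlas = (\<lambda>t0. (cis ` {t0<..<t0 + 2 * pi}, the_inv_into {t0<..<t0 + 2 * pi} cis)) ` UNIV,
     model = UNIV, normal = 0\<rparr>"

definition smooth_map ::
  "('m, 'e::euclidean_space) mfd \<Rightarrow> ('n, 'f::euclidean_space) mfd \<Rightarrow> ('m \<Rightarrow> 'n) \<Rightarrow> bool" where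
  "smooth_map M N f \<longleftrightarrow> continuous_map (mtop M) (mtop N) f \<and>
     (\<forall>c\<in>atlas M. \<forall>d\<in>atlas N.
        smooth_on (snd c ` {p \<in> fst c. f p \<in> fst d}) (snd d \<circ> f \<circ> cinv c))"

definition diffeo ::
  "('m, 'e::euclidean_space) mfd \<Rightarrow> ('n, 'f::euclidean_space) mfd \<Rightarrow> ('m \<Rightarrow> 'n) \<Rightarrow> bool" where
  "diffeo M N f \<longleftrightarrow> bij_betw f (pts M) (pts N) \<and> smooth_map M N f \<and>
     smooth_map N M (inv_into (pts M) f)"


section \<open>Tangent vectors\<close>

text \<open>The derivative of the map \<open>f\<close> in the charts \<open>c\<close> around \<open>p\<close> and \<open>d\<close> around \<open>f p\<close>.  It is
  uniquely determined only on the linear span of the tangent directions of the domain, that is, on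
  \<open>model M\<close>, and is only ever applied to vectors of \<open>model M\<close>.\<close>

definition chart_deriv ::
  "('m, 'e::euclidean_space) chart \<Rightarrow> ('n, 'f::euclidean_space) chart \<Rightarrow> ('m \<Rightarrow> 'n) \<Rightarrow> 'm \<Rightarrow> 'e \<Rightarrow> 'f"
  where
  "chart_deriv c d f p =
     frechet_derivative (snd d \<circ> f \<circ> cinv c) (at (snd c p) within snd c ` {q \<in> fst c. f q \<in> fst d})"

text \<open>A tangent vector at \<open>p\<close> is the family of its coordinate vectors in the charts around \<open>p\<close>,
  extended by \<open>0\<close> to all other pairs.\<close>

type_synonym ('m, 'e) tvec = "('m, 'e) chart \<Rightarrow> 'e"

definition tangent :: "('m, 'e::euclidean_space) mfd \<Rightarrow> 'm \<Rightarrow> ('m, 'e) tvec set" where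
  "tangent M p = {v.
     (\<forall>c. c \<notin> charts_at M p \<longrightarrow> v c = 0) \<and>
     (\<forall>c\<in>charts_at M p. v c \<in> model M) \<and>
     (\<forall>c\<in>charts_at M p. \<forall>d\<in>charts_at M p. v d = chart_deriv c d id p (v c))}"

definition coord_vec ::
  "('m, 'e::euclidean_space) mfd \<Rightarrow> ('m, 'e) chart \<Rightarrow> 'm \<Rightarrow> 'e \<Rightarrow> ('m, 'e) tvec" where
  "coord_vec M c p e = (\<lambda>d. if d \<in> charts_at M p then chart_deriv c d id p e else 0)"

definition tangent_map ::
  "('m, 'e::euclidean_space) mfd \<Rightarrow> ('n, 'f::euclidean_space) mfd \<Rightarrow> ('m \<Rightarrow> 'n) \<Rightarrow> 'm \<Rightarrow>
     ('m, 'e) tvec \<Rightarrow> ('n, 'f) tvec" where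
  "tangent_map M N f p v = (\<lambda>d. if d \<in> charts_at N (f p)
     then (let c = (SOME c. c \<in> charts_at M p) in chart_deriv c d f p (v c)) else 0)"


section \<open>Two-forms\<close>

type_synonym ('m, 'e) form2 = "'m \<Rightarrow> ('m, 'e) tvec \<Rightarrow> ('m, 'e) tvec \<Rightarrow> real"

text \<open>The coefficient of \<open>\<omega>\<close>, in the chart \<open>c\<close>, on the constant coordinate vector fields
  \<open>e1\<close>, \<open>e2\<close>.\<close>

definition coeff ::
  "('m, 'e::euclidean_space) mfd \<Rightarrow> ('m, 'e) form2 \<Rightarrow> ('m, 'e) chart \<Rightarrow> 'e \<Rightarrow> 'e \<Rightarrow> 'e \<Rightarrow> real" where
  "coeff M \<omega> c e1 e2 y =
     \<omega> (cinv c y) (coord_vec M c (cinv c y) e1) (coord_vec M c (cinv c y) e2)"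

definition two_form :: "('m, 'e::euclidean_space) mfd \<Rightarrow> ('m, 'e) form2 \<Rightarrow> bool" where
  "two_form M \<omega> \<longleftrightarrow>
     (\<forall>p\<in>pts M. \<forall>u\<in>tangent M p. \<forall>v\<in>tangent M p. \<forall>w\<in>tangent M p. \<forall>r s.
        \<omega> p (\<lambda>c. r *\<^sub>R u c + s *\<^sub>R v c) w = r * \<omega> p u w + s * \<omega> p v w \<and>
        \<omega> p v u = - \<omega> p u v) \<and>
     (\<forall>c\<in>atlas M. \<forall>e1\<in>model M. \<forall>e2\<in>model M. smooth_on (snd c ` fst c) (coeff M \<omega> c e1 e2))"

definition form_eq ::
  "('m, 'e::euclidean_space) mfd \<Rightarrow> ('m, 'e) form2 \<Rightarrow> ('m, 'e) form2 \<Rightarrow> bool" where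
  "form_eq M \<omega> \<eta> \<longleftrightarrow> (\<forall>p\<in>pts M. \<forall>u\<in>tangent M p. \<forall>v\<in>tangent M p. \<omega> p u v = \<eta> p u v)"

definition pullback ::
  "('m, 'e::euclidean_space) mfd \<Rightarrow> ('n, 'f::euclidean_space) mfd \<Rightarrow> ('m \<Rightarrow> 'n) \<Rightarrow>
     ('n, 'f) form2 \<Rightarrow> ('m, 'e) form2" where
  "pullback M N f \<omega> = (\<lambda>p u v. \<omega> (f p) (tangent_map M N f p u) (tangent_map M N f p v))"

text \<open>The exterior derivative in the chart \<open>c\<close>, evaluated on constant coordinate vector fields (whose
  Lie brackets vanish).\<close>

definition ext_deriv ::
  "('m, 'e::euclidean_space) mfd \<Rightarrow> ('m, 'e) form2 \<Rightarrow> ('m, 'e) chart \<Rightarrow> 'e \<Rightarrow> 'e \<Rightarrow> 'e \<Rightarrow> 'e \<Rightarrow> real"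
  where
  "ext_deriv M \<omega> c y e1 e2 e3 =
     frechet_derivative (coeff M \<omega> c e2 e3) (at y within snd c ` fst c) e1
   - frechet_derivative (coeff M \<omega> c e1 e3) (at y within snd c ` fst c) e2
   + frechet_derivative (coeff M \<omega> c e1 e2) (at y within snd c ` fst c) e3"

definition closed_form :: "('m, 'e::euclidean_space) mfd \<Rightarrow> ('m, 'e) form2 \<Rightarrow> bool" where
  "closed_form M \<omega> \<longleftrightarrow> (\<forall>c\<in>atlas M. \<forall>y\<in>snd c ` fst c.
     \<forall>e1\<in>model M. \<forall>e2\<in>model M. \<forall>e3\<in>model M. ext_deriv M \<omega> c y e1 e2 e3 = 0)"

definition nondegenerate :: "('m, 'e::euclidean_space) mfd \<Rightarrow> ('m, 'e) form2 \<Rightarrow> bool" where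
  "nondegenerate M \<omega> \<longleftrightarrow>
     (\<forall>p\<in>pts M. \<forall>u\<in>tangent M p. (\<forall>v\<in>tangent M p. \<omega> p u v = 0) \<longrightarrow> u = (\<lambda>_. 0))"

definition symplectic_form :: "('m, 'e::euclidean_space) mfd \<Rightarrow> ('m, 'e) form2 \<Rightarrow> bool" where
  "symplectic_form M \<omega> \<longleftrightarrow> two_form M \<omega> \<and> closed_form M \<omega> \<and> nondegenerate M \<omega>"


section \<open>Circle actions near the boundary and reduction\<close>

definition free_circle_action ::
  "('m, 'e::euclidean_space) mfd \<Rightarrow> (complex \<Rightarrow> 'm \<Rightarrow> 'm) \<Rightarrow> bool" where
  "free_circle_action N a \<longleftrightarrow>
     smooth_map (prod_mfd circle N) N (\<lambda>(z, x). a z x) \<and>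
     (\<forall>x\<in>pts N. a 1 x = x) \<and>
     (\<forall>z\<in>S1. \<forall>w\<in>S1. \<forall>x\<in>pts N. a (z * w) x = a z (a w x)) \<and>
     (\<forall>z\<in>S1. \<forall>x\<in>pts N. a z x = x \<longrightarrow> z = 1)"

definition free_circle_action_near_boundary ::
  "('m, 'e::euclidean_space) mfd \<Rightarrow> 'm set \<Rightarrow> (complex \<Rightarrow> 'm \<Rightarrow> 'm) \<Rightarrow> bool" where
  "free_circle_action_near_boundary M U a \<longleftrightarrow>
     openin (mtop M) U \<and> boundary M \<subseteq> U \<and> free_circle_action (open_submfd M U) a"

definition circle_orbit :: "(complex \<Rightarrow> 'm \<Rightarrow> 'm) \<Rightarrow> 'm \<Rightarrow> 'm set" where
  "circle_orbit a x = (\<lambda>z. a z x) ` S1"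

definition generator ::
  "('m, 'e::euclidean_space) mfd \<Rightarrow> (complex \<Rightarrow> 'm \<Rightarrow> 'm) \<Rightarrow> 'm \<Rightarrow> ('m, 'e) tvec" where
  "generator N a x = (\<lambda>c. if c \<in> charts_at N x
     then vector_derivative (\<lambda>t. snd c (a (cis t) x)) (at 0) else 0)"

definition invariant_form ::
  "('m, 'e::euclidean_space) mfd \<Rightarrow> (complex \<Rightarrow> 'm \<Rightarrow> 'm) \<Rightarrow> ('m, 'e) form2 \<Rightarrow> bool" where
  "invariant_form N a \<omega> \<longleftrightarrow> (\<forall>z\<in>S1. form_eq N (pullback N N (a z) \<omega>) \<omega>)"

definition basic_form ::
  "('m, 'e::euclidean_space) mfd \<Rightarrow> (complex \<Rightarrow> 'm \<Rightarrow> 'm) \<Rightarrow> ('m, 'e) form2 \<Rightarrow> bool" where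
  "basic_form N a \<omega> \<longleftrightarrow> invariant_form N a \<omega> \<and>
     (\<forall>x\<in>pts N. \<forall>v\<in>tangent N x. \<omega> x (generator N a x) v = 0)"

definition basic_on_boundary ::
  "('m, 'e::euclidean_space) mfd \<Rightarrow> (complex \<Rightarrow> 'm \<Rightarrow> 'm) \<Rightarrow> ('m, 'e) form2 \<Rightarrow> bool" where
  "basic_on_boundary M a \<beta> \<longleftrightarrow> basic_form (boundary_mfd M) a (pullback (boundary_mfd M) M id \<beta>)"

definition invariant_near_boundary ::
  "('m, 'e::euclidean_space) mfd \<Rightarrow> 'm set \<Rightarrow> (complex \<Rightarrow> 'm \<Rightarrow> 'm) \<Rightarrow> ('m, 'e) form2 \<Rightarrow> bool" where
  "invariant_near_boundary M U a \<beta> \<longleftrightarrow>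
     (\<exists>W. openin (mtop M) W \<and> boundary M \<subseteq> W \<and> W \<subseteq> U \<and> (\<forall>z\<in>S1. \<forall>x\<in>W. a z x \<in> W) \<and>
        invariant_form (open_submfd M W) a (pullback (open_submfd M W) M id \<beta>))"

definition principal_circle_bundle ::
  "('p, 'e::euclidean_space) mfd \<Rightarrow> (complex \<Rightarrow> 'p \<Rightarrow> 'p) \<Rightarrow> ('b, 'f::euclidean_space) mfd \<Rightarrow>
     ('p \<Rightarrow> 'b) \<Rightarrow> bool" where
  "principal_circle_bundle P a B \<pi> \<longleftrightarrow> smooth_map P B \<pi> \<and>
     (\<forall>b\<in>pts B. \<exists>V \<Phi>. openin (mtop B) V \<and> b \<in> V \<and>
        diffeo (prod_mfd circle (open_submfd B V)) (open_submfd P {x \<in> pts P. \<pi> x \<in> V}) \<Phi> \<and>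
        (\<forall>z\<in>S1. \<forall>v\<in>V. \<pi> (\<Phi> (z, v)) = v) \<and>
        (\<forall>w\<in>S1. \<forall>z\<in>S1. \<forall>v\<in>V. \<Phi> (w * z, v) = a w (\<Phi> (z, v))))"

text \<open>\<open>R\<close> is the orbit space of the boundary, with the manifold structure for which the quotient map
  is a principal circle bundle; that property determines the structure uniquely.\<close>

definition reduced_mfd ::
  "('m, 'e::euclidean_space) mfd \<Rightarrow> (complex \<Rightarrow> 'm \<Rightarrow> 'm) \<Rightarrow> ('m set, 'f::euclidean_space) mfd \<Rightarrow> bool"
  where
  "reduced_mfd M a R \<longleftrightarrow> manifold R \<and> boundary R = {} \<and>
     pts R = circle_orbit a ` boundary M \<and>
     principal_circle_bundle (boundary_mfd M) a R (circle_orbit a)"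

text \<open>\<open>\<beta>R\<close> is the form on the reduced space whose pullback to the boundary is the pullback of \<open>\<beta>\<close>;
  two such forms agree in the sense of \<^const>\<open>form_eq\<close>.\<close>

definition reduced_form ::
  "('m, 'e::euclidean_space) mfd \<Rightarrow> (complex \<Rightarrow> 'm \<Rightarrow> 'm) \<Rightarrow> ('m set, 'f::euclidean_space) mfd \<Rightarrow>
     ('m, 'e) form2 \<Rightarrow> ('m set, 'f) form2 \<Rightarrow> bool" where
  "reduced_form M a R \<beta> \<beta>R \<longleftrightarrow> two_form R \<beta>R \<and>
     form_eq (boundary_mfd M) (pullback (boundary_mfd M) R (circle_orbit a) \<beta>R)
       (pullback (boundary_mfd M) M id \<beta>)"

end

theory Submission
  imports Defs
begin

text \<open>
  Near a point of the reduced space the bundle \<open>\<partial>M \<rightarrow> M\<^sub>r\<^sub>e\<^sub>d\<close> has a smooth section \<open>s\<close>, and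
  \<open>\<beta>\<^sub>r\<^sub>e\<^sub>d = s\<^sup>*\<beta>\<close>, so \<open>\<beta>\<^sub>r\<^sub>e\<^sub>d\<close> is closed because \<open>\<beta>\<close> is.  For nondegeneracy, let \<open>K = T\<^sub>p\<partial>M\<close>, a
  hyperplane of \<open>T\<^sub>pM\<close>.  The generator \<open>X \<in> K\<close> of the action is nonzero and \<open>\<beta>\<close>-orthogonal to \<open>K\<close>.
  If \<open>w \<in> K\<close> lifts a vector in the kernel of \<open>\<beta>\<^sub>r\<^sub>e\<^sub>d\<close>, then \<open>w\<close> is also orthogonal to \<open>K\<close>, and for any
  \<open>n\<close> transverse to \<open>K\<close> the vector \<open>\<beta>(X, n) w - \<beta>(w, n) X\<close> is orthogonal to everything, hence \<open>0\<close>.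
  As \<open>\<beta>(X, n) \<noteq> 0\<close>, \<open>w\<close> is a multiple of \<open>X\<close> and projects to \<open>0\<close>.
\<close>

section \<open>Derivatives on half-spaces\<close>

text \<open>Chart images are relatively open in a half-space of a linear subspace, so a Frechet
  derivative within a chart image need not be determined on the whole ambient space. It is
  determined on \<open>model M\<close>, and the chain rules for \<open>chart_deriv\<close> all come
  from this uniqueness. The same obstacle shapes the closedness argument: commuting pullback with
  the exterior derivative needs symmetric second derivatives of the section, but chart images of
  \<open>R\<close> need not be open. The section therefore enters as
  \<open>y \<mapsto> G (0, y)\<close>, with \<open>G\<close> smooth on an open set of the ambient
  product space, where the classical symmetry applies. In a chart around p, K is the orthogonal
  complement of \<open>normal M\<close> in the model, and \<open>normal M\<close> itself serves as
  the transverse vector n. The number \<beta>(X, n) is nonzero because X is already orthogonal to K: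
  if it were also orthogonal to n, nondegeneracy would force X = 0.\<close>

lemma second_difference_mvt:
  fixes \<phi> :: "'a::real_normed_vector \<Rightarrow> real"
  assumes S: "\<And>s r. 0 \<le> s \<Longrightarrow> s \<le> t \<Longrightarrow> 0 \<le> r \<Longrightarrow> r \<le> t \<Longrightarrow> x + s *\<^sub>R u + r *\<^sub>R v \<in> W"
    and D1: "\<And>y. y \<in> W \<Longrightarrow> (\<phi> has_derivative D y) (at y)"
    and D2: "\<And>y. y \<in> W \<Longrightarrow> ((\<lambda>z. D z u) has_derivative E y) (at y)"
    and t: "0 < t"
  shows "\<exists>s r. 0 \<le> s \<and> s \<le> t \<and> 0 \<le> r \<and> r \<le> t \<and>
     \<phi> (x + t *\<^sub>R u + t *\<^sub>R v) - \<phi> (x + t *\<^sub>R u) - \<phi> (x + t *\<^sub>R v) + \<phi> x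
       = t\<^sup>2 * E (x + s *\<^sub>R u + r *\<^sub>R v) v"
proof -
  have lin: "linear (D y)" "linear (E y)" if "y \<in> W" for y
    using D1[OF that] D2[OF that] has_derivative_linear by blast+
  \<comment> \<open>The second difference is \<open>\<psi> t - \<psi> 0\<close>. The mean value
    theorem is used twice: on \<psi> in direction u, then on the resulting difference of
    \<open>D _ u\<close> in direction v. The summand \<open>0 *\<^sub>R v\<close> gives both terms
    the same shape, so that the fact \<open>a\<close> below covers them with r = t and r =
    0.\<close>
  define \<psi> where "\<psi> s = \<phi> (x + s *\<^sub>R u + t *\<^sub>R v) - \<phi> (x + s *\<^sub>R u + 0 *\<^sub>R v)" for s
  have "\<exists>s\<in>{0<..<t}. \<psi> t - \<psi> 0 =
      (\<lambda>h. D (x + s *\<^sub>R u + t *\<^sub>R v) (h *\<^sub>R u) - D (x + s *\<^sub>R u + 0 *\<^sub>R v) (h *\<^sub>R u)) (t - 0)"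
  proof (rule mvt_simple[OF t])
    fix s assume s: "0 \<le> s" "s \<le> t"
    have a: "((\<lambda>s. \<phi> (x + s *\<^sub>R u + r *\<^sub>R v)) has_derivative
        (\<lambda>h. D (x + s *\<^sub>R u + r *\<^sub>R v) (h *\<^sub>R u))) (at s within {0..t})" if "0 \<le> r" "r \<le> t" for r
      by (rule has_derivative_compose[where f = "\<lambda>s. x + s *\<^sub>R u + r *\<^sub>R v" and g = \<phi>, OF _ D1[OF S[OF s that]]])
        (auto intro!: derivative_eq_intros)
    show "(\<psi> has_derivative (\<lambda>h. D (x + s *\<^sub>R u + t *\<^sub>R v) (h *\<^sub>R u) - D (x + s *\<^sub>R u + 0 *\<^sub>R v) (h *\<^sub>R u)))
        (at s within {0..t})"
      unfolding \<psi>_def by (rule has_derivative_diff) (rule a; use t in simp)+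
  qed
  then obtain s where s: "0 < s" "s < t" and
    e1: "\<psi> t - \<psi> 0 = D (x + s *\<^sub>R u + t *\<^sub>R v) (t *\<^sub>R u) - D (x + s *\<^sub>R u + 0 *\<^sub>R v) (t *\<^sub>R u)"
    by auto
  have "\<exists>r\<in>{0<..<t}. D (x + s *\<^sub>R u + t *\<^sub>R v) u - D (x + s *\<^sub>R u + 0 *\<^sub>R v) u =
      (\<lambda>h. E (x + s *\<^sub>R u + r *\<^sub>R v) (h *\<^sub>R v)) (t - 0)"
  proof (rule mvt_simple[OF t])
    fix r assume r: "0 \<le> r" "r \<le> t"
    show "((\<lambda>r. D (x + s *\<^sub>R u + r *\<^sub>R v) u) has_derivative (\<lambda>h. E (x + s *\<^sub>R u + r *\<^sub>R v) (h *\<^sub>R v))) (at r within {0..t})"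
      by (rule has_derivative_compose[where f = "\<lambda>r. x + s *\<^sub>R u + r *\<^sub>R v" and g = "\<lambda>z. D z u", OF _ D2])
        (use S[OF _ _ r, of s] s in \<open>auto intro!: derivative_eq_intros\<close>)
  qed
  then obtain r where r: "0 < r" "r < t" and
    e2: "D (x + s *\<^sub>R u + t *\<^sub>R v) u - D (x + s *\<^sub>R u + 0 *\<^sub>R v) u = E (x + s *\<^sub>R u + r *\<^sub>R v) (t *\<^sub>R v)"
    by auto
  have mem: "x + s *\<^sub>R u + t *\<^sub>R v \<in> W" "x + s *\<^sub>R u + 0 *\<^sub>R v \<in> W" "x + s *\<^sub>R u + r *\<^sub>R v \<in> W"
    by (rule S; use s r t in simp)+
  have "\<psi> t - \<psi> 0 = t * (D (x + s *\<^sub>R u + t *\<^sub>R v) u - D (x + s *\<^sub>R u + 0 *\<^sub>R v) u)"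
    by (simp only: e1 linear_cmul[OF lin(1)[OF mem(1)]] linear_cmul[OF lin(1)[OF mem(2)]]) (simp add: algebra_simps)
  also have "\<dots> = t\<^sup>2 * E (x + s *\<^sub>R u + r *\<^sub>R v) v"
    by (simp only: e2 linear_cmul[OF lin(2)[OF mem(3)]]) (simp add: power2_eq_square)
  finally show ?thesis
    using s r by (intro exI[of _ s] exI[of _ r]) (simp add: \<psi>_def)
qed

text \<open>The second difference over the parallelogram with sides t u and t v is symmetric in u
  and v. It equals t^2 times a value of \<open>E _ u v\<close> and also t^2 times a value of
  \<open>E _ v u\<close>, at points close to x, so continuity makes the two values at x differ by at
  most any e > 0.\<close>

lemma symmetric_second_derivative_real:
  fixes \<phi> :: "'a::real_normed_vector \<Rightarrow> real"
  assumes W: "open W" "x \<in> W"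
    and D1: "\<And>y. y \<in> W \<Longrightarrow> (\<phi> has_derivative D y) (at y)"
    and D2: "\<And>y e. y \<in> W \<Longrightarrow> ((\<lambda>z. D z e) has_derivative E y e) (at y)"
    and cont: "\<And>u v. continuous_on W (\<lambda>y. E y u v)"
  shows "E x u v = E x v u"
proof -
  have "\<bar>E x u v - E x v u\<bar> \<le> e" if e: "0 < e" for e
  proof -
    have c: "\<exists>d>0. \<forall>y. dist y x < d \<longrightarrow> y \<in> W \<and> dist (E y u v) (E x u v) < e / 2" for u v
    proof -
      have "continuous (at x) (\<lambda>y. E y u v)"
        using cont[of u v] W continuous_on_eq_continuous_at by blast
      then obtain d1 where d1: "d1 > 0" "\<And>y. dist y x < d1 \<Longrightarrow> dist (E y u v) (E x u v) < e / 2"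
        unfolding continuous_at_eps_delta using e by (metis half_gt_zero)
      obtain d2 where d2: "d2 > 0" "ball x d2 \<subseteq> W" using W openE by blast
      show ?thesis
        by (rule exI[of _ "min d1 d2"]) (use d1 d2 in \<open>auto simp: dist_commute mem_ball subset_iff\<close>)
    qed
    obtain d1 where d1: "d1 > 0" "\<And>y. dist y x < d1 \<Longrightarrow> y \<in> W \<and> dist (E y u v) (E x u v) < e / 2"
      using c by metis
    obtain d2 where d2: "d2 > 0" "\<And>y. dist y x < d2 \<Longrightarrow> y \<in> W \<and> dist (E y v u) (E x v u) < e / 2"
      using c by metis
    \<comment> \<open>Small enough for the whole parallelogram to lie within distance
      \<open>min d1 d2\<close> of x; the summand 1 keeps the denominator positive when u = v =
      0.\<close>
    define t where "t = min d1 d2 / (2 * (norm u + norm v + 1))"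
    have pos: "norm u + norm v + 1 > 0" using norm_ge_zero[of u] norm_ge_zero[of v] by linarith
    have t: "t > 0" unfolding t_def using d1(1) d2(1) pos by simp
    have small: "dist (x + s *\<^sub>R u + r *\<^sub>R v) x < min d1 d2" if "0 \<le> s" "s \<le> t" "0 \<le> r" "r \<le> t" for s r
    proof -
      have "dist (x + s *\<^sub>R u + r *\<^sub>R v) x = norm (s *\<^sub>R u + r *\<^sub>R v)" by (simp add: dist_norm algebra_simps)
      also have "\<dots> \<le> s * norm u + r * norm v"
        using norm_triangle_ineq[of "s *\<^sub>R u" "r *\<^sub>R v"] that by simp
      also have "\<dots> \<le> t * norm u + t * norm v" using that by (intro add_mono mult_right_mono) auto
      also have "\<dots> < t * (2 * (norm u + norm v + 1))"
        using t pos by (simp add: algebra_simps) (smt (verit) mult_nonneg_nonneg norm_ge_zero)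
      also have "\<dots> = min d1 d2" unfolding t_def using pos by (simp add: field_simps)
      finally show ?thesis .
    qed
    have small': "dist (x + s *\<^sub>R v + r *\<^sub>R u) x < min d1 d2" if "0 \<le> s" "s \<le> t" "0 \<le> r" "r \<le> t" for s r
      using small[OF that(3,4,1,2)] by (simp add: add.commute add.left_commute)
    obtain s r where sr: "0 \<le> s" "s \<le> t" "0 \<le> r" "r \<le> t"
      and e1: "\<phi> (x + t *\<^sub>R u + t *\<^sub>R v) - \<phi> (x + t *\<^sub>R u) - \<phi> (x + t *\<^sub>R v) + \<phi> x
       = t\<^sup>2 * E (x + s *\<^sub>R u + r *\<^sub>R v) u v"
      using second_difference_mvt[of t x u v W \<phi> D "\<lambda>y. E y u"] small d1(2) D1 D2 t by auto
    obtain s' r' where sr': "0 \<le> s'" "s' \<le> t" "0 \<le> r'" "r' \<le> t"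
      and e2: "\<phi> (x + t *\<^sub>R v + t *\<^sub>R u) - \<phi> (x + t *\<^sub>R v) - \<phi> (x + t *\<^sub>R u) + \<phi> x
       = t\<^sup>2 * E (x + s' *\<^sub>R v + r' *\<^sub>R u) v u"
      using second_difference_mvt[of t x v u W \<phi> D "\<lambda>y. E y v"] small' d1(2) D1 D2 t by auto
    have "x + t *\<^sub>R u + t *\<^sub>R v = x + t *\<^sub>R v + t *\<^sub>R u" by simp
    then have "t\<^sup>2 * E (x + s *\<^sub>R u + r *\<^sub>R v) u v = t\<^sup>2 * E (x + s' *\<^sub>R v + r' *\<^sub>R u) v u"
      unfolding e1[symmetric] e2[symmetric] by (simp add: add.commute add.left_commute)
    then have "E (x + s *\<^sub>R u + r *\<^sub>R v) u v = E (x + s' *\<^sub>R v + r' *\<^sub>R u) v u" using t by simp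
    moreover have "dist (E (x + s *\<^sub>R u + r *\<^sub>R v) u v) (E x u v) < e / 2"
      using d1(2) small[OF sr] by simp
    moreover have "dist (E (x + s' *\<^sub>R v + r' *\<^sub>R u) v u) (E x v u) < e / 2"
      using d2(2) small'[OF sr'] by simp
    ultimately show ?thesis unfolding dist_real_def by linarith
  qed
  then have "\<bar>E x u v - E x v u\<bar> \<le> 0" by (rule field_le_epsilon) simp
  then show ?thesis by simp
qed

lemma Ck_on_has_derivative:
  assumes "Ck_on (Suc k) W g" "x \<in> W"
  shows "(g has_derivative frechet_derivative g (at x)) (at x)"
  using assms frechet_derivative_works by auto

text \<open>Each component is the real case: \<open>Ck_on 2\<close> supplies two derivatives and the
  continuity of the second.\<close>

lemma symmetric_second_derivative:
  fixes g :: "'e::euclidean_space \<Rightarrow> 'f::euclidean_space"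
  assumes W: "open W" "x \<in> W" and g: "Ck_on 2 W g"
  shows "frechet_derivative (\<lambda>z. frechet_derivative g (at z) u) (at x) v
       = frechet_derivative (\<lambda>z. frechet_derivative g (at z) v) (at x) u"
proof (rule euclidean_eqI)
  fix b :: 'f assume "b \<in> Basis"
  have g': "Ck_on (Suc 1) W g" "\<And>u. Ck_on (Suc 0) W (\<lambda>z. frechet_derivative g (at z) u)"
    using g by (auto simp: numeral_2_eq_2)
  show "frechet_derivative (\<lambda>z. frechet_derivative g (at z) u) (at x) v \<bullet> b
       = frechet_derivative (\<lambda>z. frechet_derivative g (at z) v) (at x) u \<bullet> b"
  proof (rule symmetric_second_derivative_real[OF W, where \<phi> = "\<lambda>z. g z \<bullet> b" and D = "\<lambda>y e. frechet_derivative g (at y) e \<bullet> b"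
     and E = "\<lambda>y u v. frechet_derivative (\<lambda>z. frechet_derivative g (at z) u) (at y) v \<bullet> b"])
    fix y assume "y \<in> W"
    then show "((\<lambda>z. g z \<bullet> b) has_derivative (\<lambda>e. frechet_derivative g (at y) e \<bullet> b)) (at y)"
      using Ck_on_has_derivative[OF g'(1)] has_derivative_inner_left by blast
    show "((\<lambda>z. frechet_derivative g (at z) e \<bullet> b) has_derivative
      (\<lambda>v. frechet_derivative (\<lambda>z. frechet_derivative g (at z) e) (at y) v \<bullet> b)) (at y)" for e
      using Ck_on_has_derivative[OF g'(2) \<open>y \<in> W\<close>] has_derivative_inner_left by blast
  next
    fix u v show "continuous_on W (\<lambda>y. frechet_derivative (\<lambda>z. frechet_derivative g (at z) u) (at y) v \<bullet> b)"
      using g'(2)[of u] by (auto intro!: continuous_intros)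
  qed
qed

section \<open>One-sided directional derivatives on half-spaces\<close>

text \<open>The limit is one-sided because from a boundary point of a half-space a direction may
  stay in S for small positive t only.\<close>

lemma has_derivative_directional:
  fixes f :: "'a::real_normed_vector \<Rightarrow> 'b::real_normed_vector"
  assumes f: "(f has_derivative D) (at y within S)"
    and seg: "\<forall>\<^sub>F t in at_right 0. y + t *\<^sub>R e \<in> S"
  shows "((\<lambda>t. (f (y + t *\<^sub>R e) - f y) /\<^sub>R t) \<longlongrightarrow> D e) (at_right 0)"
proof -
  obtain d where d: "d > 0" "\<And>t. 0 < t \<Longrightarrow> t < d \<Longrightarrow> y + t *\<^sub>R e \<in> S"
    using seg unfolding eventually_at_right_field by auto
  have f': "(f has_derivative D) (at (y + 0 *\<^sub>R e) within S)" using f by simp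
  have "((\<lambda>t. f (y + t *\<^sub>R e)) has_derivative (\<lambda>h. D (h *\<^sub>R e))) (at 0 within {0<..<d})"
    by (rule has_derivative_in_compose[where f = "\<lambda>t. y + t *\<^sub>R e" and g = f, OF _ has_derivative_subset[OF f']])
      (use d in \<open>auto intro!: derivative_eq_intros\<close>)
  moreover have "D (h *\<^sub>R e) = h *\<^sub>R D e" for h
    using f has_derivative_linear linear_cmul by blast
  ultimately have "((\<lambda>t. f (y + t *\<^sub>R e)) has_derivative (\<lambda>h. h *\<^sub>R D e)) (at 0 within {0<..<d})"
    by simp
  then have "((\<lambda>t. (f (y + t *\<^sub>R e) - f y - t *\<^sub>R D e) /\<^sub>R norm t) \<longlongrightarrow> 0) (at 0 within {0<..<d})"
    by (simp add: has_derivative_within inverse_eq_divide diff_diff_eq)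
  moreover have "\<forall>\<^sub>F t in at 0 within {0<..<d}. (f (y + t *\<^sub>R e) - f y - t *\<^sub>R D e) /\<^sub>R norm t
      = (f (y + t *\<^sub>R e) - f y) /\<^sub>R t - D e"
    by (auto simp: eventually_at_filter scaleR_diff_right intro!: always_eventually)
  ultimately have "((\<lambda>t. (f (y + t *\<^sub>R e) - f y) /\<^sub>R t - D e) \<longlongrightarrow> 0) (at 0 within {0<..<d})"
    by (rule Lim_transform_eventually)
  then have "((\<lambda>t. (f (y + t *\<^sub>R e) - f y) /\<^sub>R t) \<longlongrightarrow> D e) (at 0 within {0<..<d})"
    by (rule LIM_zero_cancel)
  moreover have "at 0 within {0<..<d} = at_right (0::real)"
    using d(1) by (intro at_within_nhd[of _ "{..<d}"]) auto
  ultimately show ?thesis by simp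
qed

text \<open>A direction with \<open>0 \<le> e \<bullet> n\<close> never leaves the half-space; from
  a point with \<open>0 < y \<bullet> n\<close> any direction of E stays inside for a short time.
  For n = 0 the first case always applies.\<close>

lemma half_space_segment:
  fixes E :: "'a::euclidean_space set"
  assumes E: "subspace E" and S: "openin (top_of_set {x \<in> E. 0 \<le> x \<bullet> n}) S" and y: "y \<in> S"
    and e: "e \<in> E" "0 \<le> e \<bullet> n \<or> 0 < y \<bullet> n"
  shows "\<forall>\<^sub>F t in at_right 0. y + t *\<^sub>R e \<in> S"
proof -
  obtain W where W: "open W" "S = {x \<in> E. 0 \<le> x \<bullet> n} \<inter> W" using S by (auto simp: openin_open)
  have lim: "((\<lambda>t. y + t *\<^sub>R e) \<longlongrightarrow> y) (at_right 0)" by (auto intro!: tendsto_eq_intros)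
  have "\<forall>\<^sub>F t in at_right 0. y + t *\<^sub>R e \<in> W"
    using lim W y topological_tendstoD by blast
  moreover have "\<forall>\<^sub>F t in at_right 0. 0 \<le> (y + t *\<^sub>R e) \<bullet> n"
  proof (cases "0 \<le> e \<bullet> n")
    case True
    have "\<forall>\<^sub>F t::real in at_right 0. 0 < t" by (rule eventually_at_right_less)
    then show ?thesis
      by eventually_elim (use y W True in \<open>auto simp: inner_add_left\<close>)
  next
    case False
    then have "0 < y \<bullet> n" using e by simp
    moreover have "((\<lambda>t. (y + t *\<^sub>R e) \<bullet> n) \<longlongrightarrow> y \<bullet> n) (at_right 0)"
      using lim tendsto_inner[OF _ tendsto_const] by blast
    ultimately have "\<forall>\<^sub>F t in at_right 0. 0 < (y + t *\<^sub>R e) \<bullet> n" using order_tendstoD(1) by blast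
    then show ?thesis by eventually_elim simp
  qed
  ultimately show ?thesis
    by eventually_elim (use E y W e in \<open>auto intro!: subspace_add subspace_scale\<close>)
qed

text \<open>One of e and -e points into the half-space, where the derivative is a one-sided limit;
  linearity carries the equality from -e to e. Outside E nothing is claimed, as S contains no
  information there.\<close>

lemma half_space_derivative_unique:
  fixes E :: "'a::euclidean_space set" and f :: "'a \<Rightarrow> 'b::real_normed_vector"
  assumes E: "subspace E" and S: "openin (top_of_set {x \<in> E. 0 \<le> x \<bullet> n}) S" and y: "y \<in> S"
    and D: "(f has_derivative D) (at y within S)" "(f has_derivative D') (at y within S)"
    and e: "e \<in> E"
  shows "D e = D' e"
proof -
  have pos: "D e = D' e" if "e \<in> E" "0 \<le> e \<bullet> n" for e
  proof -
    have "\<forall>\<^sub>F t in at_right 0. y + t *\<^sub>R e \<in> S" using half_space_segment[OF E S y] that by auto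
    from has_derivative_directional[OF D(1) this] has_derivative_directional[OF D(2) this]
    show ?thesis by (rule tendsto_unique[OF trivial_limit_at_right_real])
  qed
  show ?thesis
  proof (cases "0 \<le> e \<bullet> n")
    case False
    then have "D (- e) = D' (- e)" using pos[of "- e"] e E by (simp add: subspace_neg)
    then show ?thesis
      using linear_neg[OF has_derivative_linear[OF D(1)]] linear_neg[OF has_derivative_linear[OF D(2)]] by simp
  qed (use pos e in blast)
qed

text \<open>Difference quotients of f lie in K, and a subspace of a Euclidean space is closed, so
  their limits stay in K. As before, -e stands in for an e that points outwards.\<close>

lemma half_space_derivative_in_subspace:
  fixes E :: "'a::euclidean_space set" and f :: "'a \<Rightarrow> 'b::euclidean_space"
  assumes E: "subspace E" and S: "openin (top_of_set {x \<in> E. 0 \<le> x \<bullet> n}) S" and y: "y \<in> S"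
    and D: "(f has_derivative D) (at y within S)"
    and K: "subspace K" "f ` S \<subseteq> K" and e: "e \<in> E"
  shows "D e \<in> K"
proof -
  have pos: "D e \<in> K" if "e \<in> E" "0 \<le> e \<bullet> n" for e
  proof (rule Lim_in_closed_set[OF closed_subspace[OF K(1)]])
    have seg: "\<forall>\<^sub>F t in at_right 0. y + t *\<^sub>R e \<in> S" using half_space_segment[OF E S y] that by auto
    show "((\<lambda>t. (f (y + t *\<^sub>R e) - f y) /\<^sub>R t) \<longlongrightarrow> D e) (at_right 0)"
      by (rule has_derivative_directional[OF D seg])
    show "\<forall>\<^sub>F t in at_right 0. (f (y + t *\<^sub>R e) - f y) /\<^sub>R t \<in> K"
      using seg by eventually_elim (use K y in \<open>auto intro!: subspace_scale subspace_diff\<close>)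
  qed simp
  show ?thesis
  proof (cases "0 \<le> e \<bullet> n")
    case False
    then have "D (- e) \<in> K" using pos[of "- e"] e E by (simp add: subspace_neg)
    then show ?thesis
      using linear_neg[OF has_derivative_linear[OF D]] subspace_neg[OF K(1), of "D (- e)"] by simp
  qed (use pos e in blast)
qed

section \<open>Smooth maps on arbitrary sets\<close>

text \<open>The derivative of a local smooth extension shows that some derivative within A exists;
  \<open>frechet_derivative\<close> then picks one, possibly different from that of the
  extension.\<close>

lemma smooth_on_has_derivative:
  assumes "smooth_on A f" "x \<in> A"
  shows "(f has_derivative frechet_derivative f (at x within A)) (at x within A)"
proof -
  obtain W g where W: "open W" "x \<in> W" "\<forall>k. Ck_on k W g" "\<forall>y\<in>A \<inter> W. g y = f y"
    using assms unfolding smooth_on_def by blast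
  have "(g has_derivative frechet_derivative g (at x)) (at x)"
    using W(2) W(3)[rule_format, of "Suc 0"] by (rule Ck_on_has_derivative[rotated])
  then have "(g has_derivative frechet_derivative g (at x)) (at x within A \<inter> W)"
    by (rule has_derivative_at_withinI)
  then have "(f has_derivative frechet_derivative g (at x)) (at x within A \<inter> W)"
    by (rule has_derivative_transform[rotated 2]) (use W assms in auto)
  moreover have "at x within A \<inter> W = at x within A"
    using W by (intro at_within_nhd[of _ W]) auto
  ultimately show ?thesis
    unfolding frechet_derivative_works[symmetric] by (auto simp: differentiable_def)
qed

lemma smooth_on_subset:
  assumes "smooth_on B f" "A \<subseteq> B" "\<And>x. x \<in> A \<Longrightarrow> g x = f x"
  shows "smooth_on A g"
  unfolding smooth_on_def
proof
  fix x assume "x \<in> A"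
  then have "x \<in> B" using assms(2) by blast
  with assms(1) obtain W h where W: "open W" "x \<in> W" "\<forall>k. Ck_on k W h" "\<forall>y\<in>B \<inter> W. h y = f y"
    unfolding smooth_on_def by blast
  have "\<forall>y\<in>A \<inter> W. h y = g y"
    using W(4) assms(2,3) by (metis IntE IntI subsetD)
  with W(1-3) show "\<exists>W h. open W \<and> x \<in> W \<and> (\<forall>k. Ck_on k W h) \<and> (\<forall>y\<in>A \<inter> W. h y = g y)"
    by blast
qed

section \<open>Charts and tangent maps\<close>

lemma chart_inj_on:
  assumes "manifold M" "c \<in> atlas M"
  shows "inj_on (snd c) (fst c)"
proof -
  have "homeomorphic_map (subtopology (mtop M) (fst c)) (top_of_set (snd c ` fst c)) (snd c)"
    "openin (mtop M) (fst c)"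
    using assms unfolding manifold_def by blast+
  then show ?thesis
    using homeomorphic_imp_injective_map openin_subset by (metis topspace_subtopology_subset)
qed

lemma cinv_chart:
  assumes "manifold M" "c \<in> atlas M" "p \<in> fst c"
  shows "cinv c (snd c p) = p"
  unfolding cinv_def using chart_inj_on[OF assms(1,2)] assms(3) by simp

lemma fst_chart_subset_pts:
  assumes "manifold M" "c \<in> atlas M"
  shows "fst c \<subseteq> pts M"
  using assms unfolding manifold_def by blast

lemma openin_chart_domain:
  assumes "manifold M" "c \<in> atlas M"
  shows "openin (mtop M) (fst c)"
  using assms unfolding manifold_def by blast

lemma chart_exists:
  assumes "manifold M" "p \<in> pts M"
  obtains c where "c \<in> atlas M" "p \<in> fst c"
  using assms unfolding manifold_def by blast

lemma subspace_model:
  assumes "manifold M"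
  shows "subspace (model M)"
  using assms unfolding manifold_def by blast

lemma openin_chart_image:
  assumes M: "manifold M" "c \<in> atlas M" and Q: "openin (mtop M) Q" "Q \<subseteq> fst c"
  shows "openin (top_of_set (half_model M)) (snd c ` Q)"
proof -
  have h: "homeomorphic_map (subtopology (mtop M) (fst c)) (top_of_set (snd c ` fst c)) (snd c)"
    "openin (mtop M) (fst c)" "openin (top_of_set (half_model M)) (snd c ` fst c)"
    using M unfolding manifold_def by blast+
  have "openin (subtopology (mtop M) (fst c)) Q"
    using Q h(2) by (simp add: openin_open_subtopology)
  then have "openin (top_of_set (snd c ` fst c)) (snd c ` Q)"
    using h(1) homeomorphic_map_openness_eq by blast
  then show ?thesis using h(3) openin_trans by blast
qed

lemma chart_image_subset:
  assumes M: "manifold M" "c \<in> atlas M"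
  shows "snd c ` fst c \<subseteq> half_model M"
  using openin_chart_image[OF M openin_chart_domain[OF M]] openin_subset by fastforce

lemma chart_in_model:
  assumes "manifold M" "c \<in> atlas M" "p \<in> fst c"
  shows "snd c p \<in> model M"
  using chart_image_subset[OF assms(1,2)] assms(3) unfolding half_model_def by blast

lemma openin_overlap:
  assumes M: "manifold M" "c \<in> atlas M" and N: "manifold N" "d \<in> atlas N" and f: "smooth_map M N f"
  shows "openin (mtop M) {p \<in> fst c. f p \<in> fst d}"
proof -
  have "openin (mtop M) {p \<in> topspace (mtop M). f p \<in> fst d}"
    using f openin_chart_domain[OF N] openin_continuous_map_preimage unfolding smooth_map_def by blast
  then have "openin (mtop M) (fst c \<inter> {p \<in> topspace (mtop M). f p \<in> fst d})"
    using openin_chart_domain[OF M] by blast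
  moreover have "fst c \<inter> {p \<in> topspace (mtop M). f p \<in> fst d} = {p \<in> fst c. f p \<in> fst d}"
    using fst_chart_subset_pts[OF M] unfolding pts_def by blast
  ultimately show ?thesis by simp
qed

section \<open>Derivatives of maps in charts\<close>

lemma chart_deriv_has_derivative:
  assumes "c \<in> atlas M" "d \<in> atlas N" "smooth_map M N f" "p \<in> fst c" "f p \<in> fst d"
  shows "((snd d \<circ> f \<circ> cinv c) has_derivative chart_deriv c d f p)
     (at (snd c p) within snd c ` {q \<in> fst c. f q \<in> fst d})"
  unfolding chart_deriv_def
  by (rule smooth_on_has_derivative) (use assms in \<open>auto simp: smooth_map_def\<close>)

lemma linear_chart_deriv:
  assumes "c \<in> atlas M" "d \<in> atlas N" "smooth_map M N f" "p \<in> fst c" "f p \<in> fst d"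
  shows "linear (chart_deriv c d f p)"
  using chart_deriv_has_derivative[OF assms] has_derivative_linear by blast

lemma chart_deriv_in_model:
  assumes M: "manifold M" "c \<in> atlas M" and N: "manifold N" "d \<in> atlas N" and f: "smooth_map M N f"
    and p: "p \<in> fst c" "f p \<in> fst d" and e: "e \<in> model M"
  shows "chart_deriv c d f p e \<in> model N"
proof (rule half_space_derivative_in_subspace[OF subspace_model[OF M(1)] _ _
      chart_deriv_has_derivative[OF M(2) N(2) f p] subspace_model[OF N(1)] _ e])
  show "openin (top_of_set {x \<in> model M. 0 \<le> x \<bullet> normal M}) (snd c ` {q \<in> fst c. f q \<in> fst d})"
    using openin_chart_image[OF M openin_overlap[OF M N f]] unfolding half_model_def by blast
qed (use p M N cinv_chart[OF M] chart_in_model[OF N] in auto)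

lemma chart_deriv_eqI:
  assumes M: "manifold M" "c \<in> atlas M" and N: "manifold N" "d \<in> atlas N" and f: "smooth_map M N f"
    and Q: "openin (mtop M) Q" "p \<in> Q" "\<And>q. q \<in> Q \<Longrightarrow> q \<in> fst c \<and> f q \<in> fst d \<and> F (snd c q) = snd d (f q)"
    and F: "(F has_derivative D) (at (snd c p) within snd c ` Q)" and e: "e \<in> model M"
  shows "chart_deriv c d f p e = D e"
proof (rule half_space_derivative_unique[OF subspace_model[OF M(1)] _ _ _ F e])
  show "openin (top_of_set {x \<in> model M. 0 \<le> x \<bullet> normal M}) (snd c ` Q)"
    using openin_chart_image[OF M] Q unfolding half_model_def by blast
  have p: "p \<in> fst c" "f p \<in> fst d" using Q by auto
  have "((snd d \<circ> f \<circ> cinv c) has_derivative chart_deriv c d f p) (at (snd c p) within snd c ` Q)"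
    by (rule has_derivative_subset[OF chart_deriv_has_derivative[OF M(2) N(2) f p]]) (use Q in auto)
  then show "(F has_derivative chart_deriv c d f p) (at (snd c p) within snd c ` Q)"
    by (rule has_derivative_transform[rotated 2]) (use Q cinv_chart[OF M] in auto)
qed (use Q in auto)

text \<open>Chain rule. The composite is a separate variable \<open>h\<close>, so that changes of
  the source or target chart are the instances in which one factor is \<open>id\<close>.\<close>

lemma chart_deriv_comp:
  assumes M: "manifold M" "c \<in> atlas M" and N: "manifold N" "d \<in> atlas N" and L: "manifold L" "e \<in> atlas L"
    and f: "smooth_map M N f" and g: "smooth_map N L g" and h: "smooth_map M L h"
    and hgf: "\<And>x. x \<in> pts M \<Longrightarrow> h x = g (f x)"
    and p: "p \<in> fst c" "f p \<in> fst d" "h p \<in> fst e" and v: "v \<in> model M"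
  shows "chart_deriv c e h p v = chart_deriv d e g (f p) (chart_deriv c d f p v)"
proof (rule chart_deriv_eqI[OF M L h _ _ _ _ v])
  \<comment> \<open>The composite can be read through \<open>d\<close> only where f lands in the
    domain of \<open>d\<close>, so the overlap of \<open>c\<close> and \<open>e\<close> is cut down
    to that part.\<close>
  let ?Q = "{q \<in> fst c. f q \<in> fst d} \<inter> {q \<in> fst c. h q \<in> fst e}"
  have hq: "h q = g (f q)" if "q \<in> fst c" for q using hgf that fst_chart_subset_pts[OF M] by blast
  show "openin (mtop M) ?Q" using openin_overlap[OF M N f] openin_overlap[OF M L h] by blast
  have 1: "((snd d \<circ> f \<circ> cinv c) has_derivative chart_deriv c d f p) (at (snd c p) within snd c ` ?Q)"
    by (rule has_derivative_subset[OF chart_deriv_has_derivative[OF M(2) N(2) f p(1,2)]]) auto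
  have eq: "(snd d \<circ> f \<circ> cinv c) (snd c p) = snd d (f p)" using p cinv_chart[OF M] by simp
  have gp: "g (f p) \<in> fst e" using p hq by simp
  have "(snd d \<circ> f \<circ> cinv c) ` snd c ` ?Q \<subseteq> snd d ` {q \<in> fst d. g q \<in> fst e}"
    using hq cinv_chart[OF M] by auto
  from has_derivative_subset[OF chart_deriv_has_derivative[OF N(2) L(2) g p(2) gp] this]
  have 2: "((snd e \<circ> g \<circ> cinv d) has_derivative chart_deriv d e g (f p))
      (at ((snd d \<circ> f \<circ> cinv c) (snd c p)) within (snd d \<circ> f \<circ> cinv c) ` snd c ` ?Q)"
    unfolding eq .
  show "((\<lambda>x. (snd e \<circ> g \<circ> cinv d) ((snd d \<circ> f \<circ> cinv c) x)) has_derivative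
      (\<lambda>v. chart_deriv d e g (f p) (chart_deriv c d f p v))) (at (snd c p) within snd c ` ?Q)"
    by (rule has_derivative_in_compose[OF 1 2])
  show "q \<in> fst c \<and> h q \<in> fst e \<and> (snd e \<circ> g \<circ> cinv d) ((snd d \<circ> f \<circ> cinv c) (snd c q)) = snd e (h q)"
    if "q \<in> ?Q" for q using that cinv_chart[OF M] cinv_chart[OF N] hq by auto
qed (use p in auto)

lemma smooth_map_id:
  assumes M: "manifold M"
  shows "smooth_map M M id"
proof -
  have "smooth_on (snd c ` (fst c \<inter> fst d)) (snd d \<circ> cinv c)" if "c \<in> atlas M" "d \<in> atlas M" for c d
    using M that unfolding manifold_def by blast
  moreover have "{p \<in> fst c. id p \<in> fst d} = fst c \<inter> fst d" for c d :: "('a, 'b) chart" by auto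
  ultimately show ?thesis unfolding smooth_map_def by simp
qed

lemma chart_deriv_id:
  assumes M: "manifold M" "c \<in> atlas M" and p: "p \<in> fst c" and v: "v \<in> model M"
  shows "chart_deriv c c id p v = v"
  by (rule chart_deriv_eqI[OF M M smooth_map_id[OF M(1)] openin_chart_domain[OF M] p _ _ v,
      where F = "\<lambda>x. x" and D = "\<lambda>x. x"]) auto

lemma chart_deriv_change_source:
  assumes M: "manifold M" "c \<in> atlas M" "c' \<in> atlas M" and N: "manifold N" "d \<in> atlas N"
    and f: "smooth_map M N f" and p: "p \<in> fst c" "p \<in> fst c'" "f p \<in> fst d" and v: "v \<in> model M"
  shows "chart_deriv c' d f p (chart_deriv c c' id p v) = chart_deriv c d f p v"
  using chart_deriv_comp[OF M(1,2) M(1,3) N smooth_map_id[OF M(1)] f f, of p v] p v by simp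

lemma chart_deriv_change_target:
  assumes M: "manifold M" "c \<in> atlas M" and N: "manifold N" "d \<in> atlas N" "d' \<in> atlas N"
    and f: "smooth_map M N f" and p: "p \<in> fst c" "f p \<in> fst d" "f p \<in> fst d'" and v: "v \<in> model M"
  shows "chart_deriv d d' id (f p) (chart_deriv c d f p v) = chart_deriv c d' f p v"
  using chart_deriv_comp[OF M N(1,2) N(1,3) f smooth_map_id[OF N(1)] f, of p v] p v by simp

section \<open>Tangent vectors in coordinates\<close>

lemma coord_vec_in_tangent:
  assumes M: "manifold M" "c \<in> atlas M" and p: "p \<in> fst c" and v: "v \<in> model M"
  shows "coord_vec M c p v \<in> tangent M p"
proof -
  have "chart_deriv c d id p v \<in> model M" if "d \<in> atlas M" "p \<in> fst d" for d
    using chart_deriv_in_model[OF M M(1) that(1) smooth_map_id[OF M(1)] p _ v] that(2) by simp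
  moreover have "chart_deriv d d' id p (chart_deriv c d id p v) = chart_deriv c d' id p v"
    if "d \<in> atlas M" "p \<in> fst d" "d' \<in> atlas M" "p \<in> fst d'" for d d'
    using chart_deriv_change_source[OF M that(1) M(1) that(3) smooth_map_id[OF M(1)] p that(2) _ v] that(4) by simp
  ultimately show ?thesis by (simp add: tangent_def coord_vec_def charts_at_def)
qed

lemma tangent_eq_coord_vec:
  assumes "c \<in> atlas M" "p \<in> fst c" "u \<in> tangent M p"
  shows "u c \<in> model M" "u = coord_vec M c p (u c)"
proof -
  have c: "c \<in> charts_at M p" using assms by (simp add: charts_at_def)
  then show "u c \<in> model M" using assms(3) unfolding tangent_def by blast
  show "u = coord_vec M c p (u c)"
  proof
    fix d
    have "u d = 0" if "d \<notin> charts_at M p" using assms(3) that unfolding tangent_def by blast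
    moreover have "u d = chart_deriv c d id p (u c)" if "d \<in> charts_at M p"
      using assms(3) c that unfolding tangent_def by blast
    ultimately show "u d = coord_vec M c p (u c) d" by (auto simp only: coord_vec_def split: if_split)
  qed
qed

lemma coord_vec_apply:
  assumes M: "manifold M" "c \<in> atlas M" and p: "p \<in> fst c" and v: "v \<in> model M"
  shows "coord_vec M c p v c = v"
  using chart_deriv_id[OF assms] M p by (simp add: coord_vec_def charts_at_def)

lemma coord_vec_linear:
  assumes M: "manifold M" "c \<in> atlas M" and p: "p \<in> fst c"
  shows "coord_vec M c p (r *\<^sub>R v + s *\<^sub>R w) = (\<lambda>d. r *\<^sub>R coord_vec M c p v d + s *\<^sub>R coord_vec M c p w d)"
proof
  fix d show "coord_vec M c p (r *\<^sub>R v + s *\<^sub>R w) d = r *\<^sub>R coord_vec M c p v d + s *\<^sub>R coord_vec M c p w d"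
  proof (cases "d \<in> charts_at M p")
    case True
    then have "linear (chart_deriv c d id p)"
      using p by (intro linear_chart_deriv[OF M(2) _ smooth_map_id[OF M(1)]]) (auto simp: charts_at_def)
    then show ?thesis using True by (simp add: coord_vec_def linear_add linear_cmul)
  qed (simp add: coord_vec_def)
qed

text \<open>\<open>tangent_map\<close> reads its argument in an arbitrarily chosen chart. Changing
  the source chart removes this choice, and changing the target chart shows that the values form the
  coordinate family of one vector.\<close>

lemma tangent_map_coord_vec:
  assumes M: "manifold M" "c \<in> atlas M" and N: "manifold N" "d \<in> atlas N" and f: "smooth_map M N f"
    and p: "p \<in> fst c" "f p \<in> fst d" and v: "v \<in> model M"
  shows "tangent_map M N f p (coord_vec M c p v) = coord_vec N d (f p) (chart_deriv c d f p v)"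
proof
  fix d'
  define c0 where "c0 = (SOME c. c \<in> charts_at M p)"
  have c0: "c0 \<in> charts_at M p" unfolding c0_def by (rule someI[of _ c]) (use M p in \<open>auto simp: charts_at_def\<close>)
  show "tangent_map M N f p (coord_vec M c p v) d' = coord_vec N d (f p) (chart_deriv c d f p v) d'"
  proof (cases "d' \<in> charts_at N (f p)")
    case True
    then have d': "d' \<in> atlas N" "f p \<in> fst d'" and c0': "c0 \<in> atlas M" "p \<in> fst c0"
      using c0 by (auto simp: charts_at_def)
    have "tangent_map M N f p (coord_vec M c p v) d' = chart_deriv c0 d' f p (chart_deriv c c0 id p v)"
      using True c0 by (simp add: tangent_map_def c0_def[symmetric] coord_vec_def)
    also have "\<dots> = chart_deriv c d' f p v"
      by (rule chart_deriv_change_source[OF M c0'(1) N(1) d'(1) f p(1) c0'(2) d'(2) v])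
    also have "\<dots> = chart_deriv d d' id (f p) (chart_deriv c d f p v)"
      by (rule chart_deriv_change_target[OF M N d'(1) f p d'(2) v, symmetric])
    finally show ?thesis using True by (simp add: coord_vec_def)
  qed (simp add: tangent_map_def coord_vec_def)
qed

text \<open>At a boundary point of one chart that is interior in another, the inner product of the
  transition map with the normal would have an interior minimum, so its derivative, which is onto,
  would be orthogonal to the normal.\<close>

lemma boundary_chart_normal:
  assumes M: "manifold M" "c \<in> atlas M" and p: "p \<in> fst c" "p \<in> boundary M"
  shows "snd c p \<bullet> normal M = 0"
proof (rule ccontr)
  let ?n = "normal M"
  assume "snd c p \<bullet> ?n \<noteq> 0"
  then have pos: "0 < snd c p \<bullet> ?n"
    using chart_image_subset[OF M] p(1) unfolding half_model_def by (auto simp: order_less_le image_subset_iff)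
  obtain c0 where c0: "c0 \<in> atlas M" "p \<in> fst c0" "snd c0 p \<bullet> ?n = 0" and n: "?n \<noteq> 0"
    using p(2) unfolding boundary_def charts_at_def by auto
  have nM: "?n \<in> model M" using M unfolding manifold_def by blast
  let ?S = "snd c ` {q \<in> fst c. id q \<in> fst c0}" and ?D = "chart_deriv c c0 id p"
  let ?h = "snd c0 \<circ> id \<circ> cinv c"
  have der: "(?h has_derivative ?D) (at (snd c p) within ?S)"
    by (rule chart_deriv_has_derivative[OF M(2) c0(1) smooth_map_id[OF M(1)]]) (use p c0 in auto)
  then have lin: "linear ?D" using has_derivative_linear by blast
  have S: "openin (top_of_set {x \<in> model M. 0 \<le> x \<bullet> ?n}) ?S"
    using openin_chart_image[OF M openin_overlap[OF M M(1) c0(1) smooth_map_id[OF M(1)]]]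
    unfolding half_model_def by blast
  \<comment> \<open>As p is interior in \<open>c\<close>, every direction of the model can be
    followed, e as well as -e, while the normal coordinate in \<open>c0\<close> starts at 0 and
    stays nonnegative.\<close>
  have ge: "0 \<le> ?D e \<bullet> ?n" if e: "e \<in> model M" for e
  proof -
    have seg: "\<forall>\<^sub>F t in at_right 0. snd c p + t *\<^sub>R e \<in> ?S"
      by (rule half_space_segment[OF subspace_model[OF M(1)] S]) (use p c0 pos e in auto)
    have "((\<lambda>t. ((?h (snd c p + t *\<^sub>R e) - ?h (snd c p)) /\<^sub>R t) \<bullet> ?n) \<longlongrightarrow> ?D e \<bullet> ?n) (at_right 0)"
      by (intro tendsto_inner has_derivative_directional[OF der seg] tendsto_const)
    moreover have "\<forall>\<^sub>F t in at_right 0. 0 \<le> ((?h (snd c p + t *\<^sub>R e) - ?h (snd c p)) /\<^sub>R t) \<bullet> ?n"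
      using seg eventually_at_right_less
    proof eventually_elim
      case (elim t)
      then obtain q where q: "q \<in> fst c" "q \<in> fst c0" "snd c p + t *\<^sub>R e = snd c q" by auto
      then have "0 \<le> snd c0 q \<bullet> ?n"
        using chart_image_subset[OF M(1) c0(1)] unfolding half_model_def by blast
      then show ?case
        using elim(2) q c0 p cinv_chart[OF M] by (simp add: inner_diff_left)
    qed
    ultimately show ?thesis by (intro tendsto_lowerbound) auto
  qed
  have zero: "?D e \<bullet> ?n = 0" if "e \<in> model M" for e
    using ge[of e] ge[of "- e"] that subspace_model[OF M(1)] linear_neg[OF lin] by (simp add: subspace_neg)
  \<comment> \<open>Witness for surjectivity: the normal carried from \<open>c0\<close> to
    \<open>c\<close>, which \<open>?D\<close> carries back.\<close>
  let ?e = "chart_deriv c0 c id p ?n"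
  have "?e \<in> model M"
    by (rule chart_deriv_in_model[OF M(1) c0(1) M smooth_map_id[OF M(1)]]) (use p c0 nM in auto)
  moreover have "?D ?e = ?n"
    using chart_deriv_change_source[OF M(1) c0(1) M(2) M(1) c0(1) smooth_map_id[OF M(1)] c0(2) p(1) _ nM]
      chart_deriv_id[OF M(1) c0(1,2) nM] c0 by simp
  ultimately show False using zero[of ?e] n by simp
qed

section \<open>The boundary as a manifold\<close>

text \<open>The coordinate map is kept, so boundary coordinates are coordinates in M and the
  inclusion of the boundary becomes the identity.\<close>

definition boundary_chart :: "('m, 'e::euclidean_space) mfd \<Rightarrow> ('m, 'e) chart \<Rightarrow> ('m, 'e) chart" where
  "boundary_chart M c = (fst c \<inter> boundary M, snd c)"

lemma fst_boundary_chart [simp]: "fst (boundary_chart M c) = fst c \<inter> boundary M"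
  and snd_boundary_chart [simp]: "snd (boundary_chart M c) = snd c"
  by (simp_all add: boundary_chart_def)

lemma boundary_mfd_simps:
  "mtop (boundary_mfd M) = subtopology (mtop M) (boundary M)"
  "atlas (boundary_mfd M) = boundary_chart M ` atlas M"
  "model (boundary_mfd M) = {x \<in> model M. x \<bullet> normal M = 0}"
  "normal (boundary_mfd M) = 0"
  "half_model (boundary_mfd M) = {x \<in> model M. x \<bullet> normal M = 0}"
  by (auto simp: boundary_mfd_def boundary_chart_def half_model_def)

lemma pts_boundary_mfd: "pts (boundary_mfd M) = boundary M"
  unfolding pts_def boundary_mfd_simps by (auto simp: boundary_def pts_def)

text \<open>\<open>cinv\<close> is an \<open>inv_into\<close> on the domain of the chart, so it
  changes as a function when the domain shrinks; injectivity fixes its values on the smaller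
  image.\<close>

lemma cinv_subset_chart:
  assumes M: "manifold M" "c \<in> atlas M" and x: "x \<in> snd c ` A" "A \<subseteq> fst c"
  shows "cinv (A, snd c) x = cinv c x"
proof -
  obtain p where p: "p \<in> A" "x = snd c p" using x by auto
  have "inj_on (snd c) A" using chart_inj_on[OF M] x(2) inj_on_subset by blast
  then have "cinv (A, snd c) x = p" unfolding cinv_def using p by simp
  then show ?thesis using cinv_chart[OF M] p x(2) by auto
qed

text \<open>The definition of \<open>boundary\<close> asks for one chart with vanishing normal
  coordinate; \<open>boundary_chart_normal\<close> makes this visible in every chart.\<close>

lemma boundary_chart_image:
  assumes M: "manifold M" "c \<in> atlas M" and n: "normal M \<noteq> 0"
  shows "snd c ` (fst c \<inter> boundary M) = snd c ` fst c \<inter> {x \<in> model M. x \<bullet> normal M = 0}"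
proof -
  have "p \<in> boundary M \<longleftrightarrow> snd c p \<in> {x \<in> model M. x \<bullet> normal M = 0}" if p: "p \<in> fst c" for p
    using boundary_chart_normal[OF M p] chart_in_model[OF M p] fst_chart_subset_pts[OF M] M n p
    unfolding boundary_def charts_at_def by blast
  then show ?thesis by blast
qed

lemma smooth_on_transition:
  assumes "manifold M" "c \<in> atlas M" "d \<in> atlas M"
  shows "smooth_on (snd c ` (fst c \<inter> fst d)) (snd d \<circ> cinv c)"
  using assms unfolding manifold_def by blast

lemma manifold_boundary_mfd:
  assumes M: "manifold M"
  shows "manifold (boundary_mfd M)"
proof -
  let ?B = "boundary M" and ?K = "{x \<in> model M. x \<bullet> normal M = 0}"
  have "subspace ?K"
    using subspace_model[OF M] unfolding subspace_def by (simp add: inner_add_left)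
  moreover have "\<Union> (fst ` boundary_chart M ` atlas M) = ?B"
  proof -
    have "\<Union> (fst ` atlas M) = pts M" using M unfolding manifold_def by blast
    moreover have "?B \<subseteq> pts M" by (auto simp: boundary_def)
    ultimately show ?thesis by auto
  qed
  moreover have "openin (subtopology (mtop M) ?B) (fst c \<inter> ?B)" if "c \<in> atlas M" for c
    using openin_chart_domain[OF M that] by (auto simp: openin_subtopology)
  moreover have "openin (top_of_set ?K) (snd c ` (fst c \<inter> ?B))" if c: "c \<in> atlas M" for c
  \<comment> \<open>With zero normal the boundary is empty, although \<open>?K\<close> is then the
    whole model.\<close>
  proof (cases "normal M = 0")
    case True
    then show ?thesis by (simp add: boundary_def)
  next
    case False
    have "openin (top_of_set (half_model M)) (snd c ` fst c)"
      using openin_chart_image[OF M c openin_chart_domain[OF M c]] by blast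
    then obtain W where "open W" "snd c ` fst c = half_model M \<inter> W" by (auto simp: openin_open)
    moreover from this have "snd c ` (fst c \<inter> ?B) = ?K \<inter> W"
      unfolding boundary_chart_image[OF M c False] by (auto simp: half_model_def)
    ultimately show ?thesis by (auto simp: openin_open)
  qed
  moreover have "homeomorphic_map (subtopology (subtopology (mtop M) ?B) (fst c \<inter> ?B))
      (top_of_set (snd c ` (fst c \<inter> ?B))) (snd c)" if c: "c \<in> atlas M" for c
  proof -
    have hom: "homeomorphic_map (subtopology (mtop M) (fst c)) (top_of_set (snd c ` fst c)) (snd c)"
      using M c unfolding manifold_def by blast
    have "topspace (subtopology (mtop M) (fst c)) = fst c"
      using fst_chart_subset_pts[OF M c] unfolding pts_def by auto
    then have "snd c ` (topspace (subtopology (mtop M) (fst c)) \<inter> (fst c \<inter> ?B))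
        = topspace (top_of_set (snd c ` fst c)) \<inter> snd c ` (fst c \<inter> ?B)"
      by auto
    from homeomorphic_map_subtopologies[OF hom this]
    have "homeomorphic_map (subtopology (subtopology (mtop M) (fst c)) (fst c \<inter> ?B))
        (subtopology (top_of_set (snd c ` fst c)) (snd c ` (fst c \<inter> ?B))) (snd c)" .
    moreover have "snd c ` fst c \<inter> snd c ` (fst c \<inter> ?B) = snd c ` (fst c \<inter> ?B)" by auto
    ultimately show ?thesis
      by (simp add: subtopology_subtopology Int_ac)
  qed
  moreover have "smooth_on (snd c ` (fst c \<inter> ?B \<inter> (fst d \<inter> ?B))) (snd d \<circ> cinv (boundary_chart M c))"
    if c: "c \<in> atlas M" and d: "d \<in> atlas M" for c d
  proof (rule smooth_on_subset[OF smooth_on_transition[OF M c d]])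
    fix x assume "x \<in> snd c ` (fst c \<inter> ?B \<inter> (fst d \<inter> ?B))"
    then have "cinv (boundary_chart M c) x = cinv c x"
      unfolding boundary_chart_def by (intro cinv_subset_chart[OF M c]) auto
    then show "(snd d \<circ> cinv (boundary_chart M c)) x = (snd d \<circ> cinv c) x" by simp
  qed auto
  moreover have "Hausdorff_space (subtopology (mtop M) ?B)" "second_countable (subtopology (mtop M) ?B)"
    using M unfolding manifold_def by (blast intro: Hausdorff_space_subtopology second_countable_subtopology)+
  moreover have "0 \<in> model M" using subspace_model[OF M] subspace_0 by blast
  ultimately show ?thesis
    unfolding manifold_def pts_boundary_mfd boundary_mfd_simps by auto
qed

lemma smooth_map_boundary_inclusion:
  assumes M: "manifold M"
  shows "smooth_map (boundary_mfd M) M id"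
  unfolding smooth_map_def boundary_mfd_simps
proof (intro conjI ballI)
  show "continuous_map (subtopology (mtop M) (boundary M)) (mtop M) id"
    by (simp add: continuous_map_id continuous_map_from_subtopology)
  fix c' d assume "c' \<in> boundary_chart M ` atlas M" and d: "d \<in> atlas M"
  then obtain c where c: "c \<in> atlas M" "c' = boundary_chart M c" by blast
  show "smooth_on (snd c' ` {p \<in> fst c'. id p \<in> fst d}) (snd d \<circ> id \<circ> cinv c')"
  proof (rule smooth_on_subset[OF smooth_on_transition[OF M c(1) d]])
    fix x assume "x \<in> snd c' ` {p \<in> fst c'. id p \<in> fst d}"
    then have "cinv c' x = cinv c x"
      unfolding c(2) boundary_chart_def by (intro cinv_subset_chart[OF M c(1)]) auto
    then show "(snd d \<circ> id \<circ> cinv c') x = (snd d \<circ> cinv c) x" by simp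
  qed (auto simp: c(2))
qed

text \<open>The inclusion is the identity in these coordinates, which places the tangent space of
  the boundary in that of M as the hyperplane \<open>model (boundary_mfd M)\<close>.\<close>

lemma chart_deriv_boundary_inclusion:
  assumes M: "manifold M" "c \<in> atlas M" and p: "p \<in> fst c" "p \<in> boundary M"
    and k: "k \<in> model (boundary_mfd M)"
  shows "chart_deriv (boundary_chart M c) c id p k = k"
  by (rule chart_deriv_eqI[OF manifold_boundary_mfd[OF M(1)] _ M smooth_map_boundary_inclusion[OF M(1)] _ _ _ _ k,
        where Q = "fst (boundary_chart M c)" and F = "\<lambda>x. x" and D = "\<lambda>x. x"])
    (use openin_chart_domain[OF manifold_boundary_mfd[OF M(1)], of "boundary_chart M c"] M p
      in \<open>auto simp: boundary_mfd_simps\<close>)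

section \<open>Pullbacks in coordinates\<close>

lemma coeff_chart:
  assumes "manifold M" "c \<in> atlas M" "p \<in> fst c"
  shows "coeff M \<omega> c e1 e2 (snd c p) = \<omega> p (coord_vec M c p e1) (coord_vec M c p e2)"
  using cinv_chart[OF assms] by (simp add: coeff_def)

lemma pullback_coord_vec:
  assumes M: "manifold M" "c \<in> atlas M" and N: "manifold N" "d \<in> atlas N" and f: "smooth_map M N f"
    and p: "p \<in> fst c" "f p \<in> fst d" and v: "v1 \<in> model M" "v2 \<in> model M"
  shows "pullback M N f \<omega> p (coord_vec M c p v1) (coord_vec M c p v2)
    = coeff N \<omega> d (chart_deriv c d f p v1) (chart_deriv c d f p v2) (snd d (f p))"
  using tangent_map_coord_vec[OF M N f p] v coeff_chart[OF N p(2)] by (simp add: pullback_def)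

text \<open>The equality of the two pullbacks that defines \<open>\<beta>R\<close>, written in
  coefficients. It is the only link between \<open>\<beta>R\<close> and \<beta>: closedness uses it
  along a section, nondegeneracy at a single point.\<close>

lemma reduced_form_coeff:
  assumes M: "manifold M" "c \<in> atlas M" and R: "reduced_mfd M a R" "d \<in> atlas R"
    and red: "reduced_form M a R \<beta> \<beta>R"
    and p: "p \<in> fst c" "p \<in> boundary M" "circle_orbit a p \<in> fst d"
    and k: "k1 \<in> model (boundary_mfd M)" "k2 \<in> model (boundary_mfd M)"
  shows "coeff R \<beta>R d (chart_deriv (boundary_chart M c) d (circle_orbit a) p k1)
      (chart_deriv (boundary_chart M c) d (circle_orbit a) p k2) (snd d (circle_orbit a p))
    = coeff M \<beta> c k1 k2 (snd c p)"
proof -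
  let ?B = "boundary_mfd M" and ?c = "boundary_chart M c" and ?\<pi> = "circle_orbit a"
  have B: "manifold ?B" "?c \<in> atlas ?B" using M manifold_boundary_mfd by (auto simp: boundary_mfd_simps)
  have R': "manifold R" "smooth_map ?B R ?\<pi>"
    using R unfolding reduced_mfd_def principal_circle_bundle_def by auto
  have p': "p \<in> fst ?c" "p \<in> pts ?B" using p by (auto simp: pts_boundary_mfd)
  note t = coord_vec_in_tangent[OF B p'(1)]
  have "pullback ?B R ?\<pi> \<beta>R p (coord_vec ?B ?c p k1) (coord_vec ?B ?c p k2)
      = pullback ?B M id \<beta> p (coord_vec ?B ?c p k1) (coord_vec ?B ?c p k2)"
    using red p'(2) t[OF k(1)] t[OF k(2)] unfolding reduced_form_def form_eq_def by blast
  then show ?thesis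
    using pullback_coord_vec[OF B R'(1) R(2) R'(2) p'(1) p(3) k]
      pullback_coord_vec[OF B M smooth_map_boundary_inclusion[OF M(1)] p'(1) _ k] p
      chart_deriv_boundary_inclusion[OF M p(1,2)] k by simp
qed

section \<open>Local trivializations of the boundary\<close>

lemma inj_on_cis: "inj_on cis {- pi<..<- pi + 2 * pi}"
  by (rule inj_on_inverseI[of _ Arg]) (auto intro!: Arg_cis)

lemma atlas_open_submfd: "c \<in> atlas M \<Longrightarrow> (fst c \<inter> V, snd c) \<in> atlas (open_submfd M V)"
  by (auto simp: open_submfd_def)

lemma atlas_prod_mfd:
  "c \<in> atlas M \<Longrightarrow> d \<in> atlas N \<Longrightarrow>
    (fst c \<times> fst d, map_prod (snd c) (snd d)) \<in> atlas (prod_mfd M N)"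
  unfolding prod_mfd_def by (simp, intro exI conjI) (rule refl | simp)+

text \<open>In charts, the trivialization \<open>\<Phi>\<close> becomes the map \<open>G\<close>, with the angle as first coordinate;
  \<open>s = \<Phi> (1, _)\<close> is a local section. The derivative of \<open>G\<close> in the angle does not vanish because
  the inverse of \<open>\<Phi>\<close> is differentiable.\<close>

lemma local_trivialization:
  fixes M :: "('m, 'e::euclidean_space) mfd" and R :: "('m set, 'f::euclidean_space) mfd"
  assumes M: "manifold M" and R: "reduced_mfd M a R" "d \<in> atlas R" and b: "b \<in> fst d"
  obtains c s W J T and G :: "real \<times> 'f \<Rightarrow> 'e"
  where "c \<in> atlas M" "open W" "\<And>k. Ck_on k W G" "openin (mtop R) T" "b \<in> T" "T \<subseteq> fst d"
    and "\<And>v. v \<in> T \<Longrightarrow> s v \<in> fst c \<inter> boundary M \<and> circle_orbit a (s v) = v \<and>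
      (0, snd d v) \<in> W \<and> snd c (s v) = G (0, snd d v)"
    and "open J" "0 \<in> J"
    and "\<And>t. t \<in> J \<Longrightarrow> a (cis t) (s b) \<in> fst c \<inter> boundary M \<and> circle_orbit a (a (cis t) (s b)) = b \<and>
      snd c (a (cis t) (s b)) = G (t, snd d b)"
    and "frechet_derivative G (at (0, snd d b)) (1, 0) \<noteq> 0"
proof -
  let ?B = "boundary_mfd M" and ?\<pi> = "circle_orbit a"
  \<comment> \<open>The circle chart with \<open>t0 = - pi\<close>, whose interval contains the
    angle 0 of the point 1.\<close>
  let ?I = "{- pi<..<- pi + 2 * pi}"
  have B: "manifold ?B" using manifold_boundary_mfd[OF M] .
  have R': "manifold R" "principal_circle_bundle ?B a R ?\<pi>" using R unfolding reduced_mfd_def by auto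
  have bR: "b \<in> pts R" using fst_chart_subset_pts[OF R'(1) R(2)] b by blast
  note triv = R'(2)[unfolded principal_circle_bundle_def, THEN conjunct2, THEN bspec, OF bR]
  obtain V \<Phi> where triv: "openin (mtop R) V \<and> b \<in> V \<and>
      diffeo (prod_mfd circle (open_submfd R V)) (open_submfd ?B {x \<in> pts ?B. ?\<pi> x \<in> V}) \<Phi> \<and>
      (\<forall>z\<in>S1. \<forall>v\<in>V. ?\<pi> (\<Phi> (z, v)) = v) \<and>
      (\<forall>w\<in>S1. \<forall>z\<in>S1. \<forall>v\<in>V. \<Phi> (w * z, v) = a w (\<Phi> (z, v)))"
    by (rule exE[OF triv], erule exE, rule that)
  note V = triv[THEN conjunct1] triv[THEN conjunct2, THEN conjunct1]
    and diff = triv[THEN conjunct2, THEN conjunct2, THEN conjunct1]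
    and \<pi>\<Phi> = triv[THEN conjunct2, THEN conjunct2, THEN conjunct2, THEN conjunct1, THEN bspec, THEN bspec]
    and a\<Phi> = triv[THEN conjunct2, THEN conjunct2, THEN conjunct2, THEN conjunct2, THEN bspec, THEN bspec, THEN bspec]
  define PV where "PV = {x \<in> pts ?B. ?\<pi> x \<in> V}"
  let ?X = "prod_mfd circle (open_submfd R V)" and ?Y = "open_submfd ?B PV"
  have VR: "V \<subseteq> topspace (mtop R)" using V(1) openin_subset by blast
  have mX: "mtop ?X = prod_topology (top_of_set S1) (subtopology (mtop R) V)"
    by (simp add: prod_mfd_def circle_def open_submfd_def)
  have ptsX: "pts ?X = S1 \<times> V" using VR unfolding pts_def mX by auto
  have mY: "mtop ?Y = subtopology (subtopology (mtop M) (boundary M)) PV"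
    by (simp add: boundary_mfd_simps open_submfd_def)
  have PVB: "PV \<subseteq> boundary M" unfolding PV_def pts_boundary_mfd by auto
  have ptsY: "pts ?Y = PV"
    using PVB unfolding pts_def mY by (auto simp: boundary_def pts_def)
  have bij: "bij_betw \<Phi> (S1 \<times> V) PV" and sm: "smooth_map ?X ?Y \<Phi>"
    and smi: "smooth_map ?Y ?X (inv_into (S1 \<times> V) \<Phi>)"
    using diff unfolding diffeo_def PV_def[symmetric] ptsX ptsY by auto
  have \<Phi>PV: "\<Phi> (z, v) \<in> PV" if "z \<in> S1" "v \<in> V" for z v
    using bij that bij_betwE by blast
  have inv: "inv_into (S1 \<times> V) \<Phi> (\<Phi> (z, v)) = (z, v)" if "z \<in> S1" "v \<in> V" for z v
    using bij that by (simp add: bij_betw_inv_into_left)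
  have S1: "cis t \<in> S1" for t by simp
  define s where "s v = \<Phi> (1, v)" for v
  have sPV: "s v \<in> PV" if "v \<in> V" for v unfolding s_def by (rule \<Phi>PV) (use that in auto)
  have acis: "a (cis t) (s v) = \<Phi> (cis t, v)" if "v \<in> V" for t v
    using a\<Phi>[OF S1, of 1 v t] that by (simp add: s_def)
  have "s b \<in> pts M" using sPV[OF V(2)] PVB unfolding boundary_def by auto
  then obtain c where c: "c \<in> atlas M" "s b \<in> fst c" using chart_exists[OF M] by blast
  define c1 where "c1 = (cis ` ?I \<times> (fst d \<inter> V), map_prod (the_inv_into ?I cis) (snd d))"
  define c2 where "c2 = (fst c \<inter> boundary M \<inter> PV, snd c)"
  have c1: "c1 \<in> atlas ?X"
  proof -
    have "(cis ` ?I, the_inv_into ?I cis) \<in> atlas circle"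
      unfolding circle_def by (simp add: image_iff) (rule exI[of _ "- pi"], simp)
    from atlas_prod_mfd[OF this atlas_open_submfd[OF R(2), of V]] show ?thesis by (simp add: c1_def)
  qed
  have "boundary_chart M c \<in> atlas ?B" using c by (simp add: boundary_mfd_simps)
  from atlas_open_submfd[OF this, of PV] have c2: "c2 \<in> atlas ?Y" unfolding c2_def by simp
  have c1t: "snd c1 (cis t, v) = (t, snd d v)" if "t \<in> ?I" for t v
    using the_inv_into_f_f[OF inj_on_cis that] by (simp add: c1_def)
  have c1inv: "cinv c1 (t, snd d v) = (cis t, v)" if "t \<in> ?I" "v \<in> fst d \<inter> V" for t v
  proof -
    have "inj_on (snd c1) (fst c1)"
    proof (rule inj_onI)
      fix q q' assume "q \<in> fst c1" "q' \<in> fst c1" and eq: "snd c1 q = snd c1 q'"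
      then obtain t v t' v' where *: "t \<in> ?I" "t' \<in> ?I" "v \<in> fst d" "v' \<in> fst d" "q = (cis t, v)" "q' = (cis t', v')"
        unfolding c1_def by auto
      with eq have "t = t'" "snd d v = snd d v'" using c1t by auto
      then show "q = q'" using * chart_inj_on[OF R'(1) R(2)] by (auto dest: inj_onD)
    qed
    moreover have "(cis t, v) \<in> fst c1" using that unfolding c1_def by auto
    ultimately show ?thesis using c1t[OF that(1), of v] unfolding cinv_def by (metis inv_into_f_f)
  qed
  have I0: "0 \<in> ?I" by simp
  let ?A = "snd c1 ` {q \<in> fst c1. \<Phi> q \<in> fst c2}"
  have Amem: "(t, snd d v) \<in> ?A" if "t \<in> ?I" "v \<in> fst d \<inter> V" "\<Phi> (cis t, v) \<in> fst c" for t v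
  proof -
    have "\<Phi> (cis t, v) \<in> PV" using \<Phi>PV[OF S1] that by blast
    then have "(cis t, v) \<in> {q \<in> fst c1. \<Phi> q \<in> fst c2}" using that PVB unfolding c1_def c2_def by auto
    then show ?thesis using c1t[OF that(1), of v] by (metis (no_types, lifting) imageI)
  qed
  have "smooth_on ?A (snd c2 \<circ> \<Phi> \<circ> cinv c1)" using sm c1 c2 unfolding smooth_map_def by blast
  moreover have "(0, snd d b) \<in> ?A" using Amem[OF I0, of b] b V(2) c(2) by (simp add: s_def)
  \<comment> \<open>\<open>G\<close> is smooth on an open subset of the ambient space, but it
    represents \<Phi> only on \<open>?A \<inter> W\<close>; this is why \<open>T\<close> and
    \<open>J\<close> are cut down below.\<close>
  ultimately obtain W G where W: "open W" "(0, snd d b) \<in> W" and G: "\<And>k. Ck_on k W G"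
    and Geq: "\<And>y. y \<in> ?A \<inter> W \<Longrightarrow> G y = (snd c2 \<circ> \<Phi> \<circ> cinv c1) y"
    unfolding smooth_on_def by meson
  have Gt: "G (t, snd d v) = snd c (\<Phi> (cis t, v))"
    if "t \<in> ?I" "v \<in> fst d \<inter> V" "\<Phi> (cis t, v) \<in> fst c" "(t, snd d v) \<in> W" for t v
    using Geq[of "(t, snd d v)"] Amem[OF that(1-3)] that(4) c1inv[OF that(1,2)] by (simp add: c2_def)
  have cont: "continuous_map (prod_topology (top_of_set S1) (subtopology (mtop R) V)) (mtop M) \<Phi>"
    using sm unfolding smooth_map_def mX mY by (blast dest: continuous_map_into_fulltopology)
  have "openin (subtopology (mtop R) V) {v \<in> topspace (subtopology (mtop R) V). s v \<in> fst c}"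
  proof (rule openin_continuous_map_preimage[OF _ openin_chart_domain[OF M c(1)]])
    have "continuous_map (subtopology (mtop R) V) (mtop M) (\<Phi> \<circ> (\<lambda>v. (1, v)))"
      by (rule continuous_map_compose[OF _ cont]) (auto intro!: continuous_map_pairedI)
    then show "continuous_map (subtopology (mtop R) V) (mtop M) s" by (simp add: s_def[abs_def] comp_def)
  qed
  then have T1: "openin (mtop R) {v \<in> V. s v \<in> fst c}"
    using V(1) VR by (simp add: openin_open_subtopology Int_absorb1 inf.absorb2)
  have *: "openin (subtopology (mtop R) (fst d)) {v \<in> topspace (subtopology (mtop R) (fst d)). snd d v \<in> {y. (0, y) \<in> W}}"
  proof (rule openin_continuous_map_preimage)
    have "homeomorphic_map (subtopology (mtop R) (fst d)) (top_of_set (snd d ` fst d)) (snd d)"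
      using R'(1) R(2) unfolding manifold_def by blast
    then show "continuous_map (subtopology (mtop R) (fst d)) euclidean (snd d)"
      by (blast dest: homeomorphic_imp_continuous_map continuous_map_into_fulltopology)
    have "open ((\<lambda>y. (0, y)) -` W)" by (intro open_vimage W continuous_intros)
    then show "openin euclidean {y. (0, y) \<in> W}" by (simp add: vimage_def)
  qed
  then have T2: "openin (mtop R) {v \<in> fst d. (0, snd d v) \<in> W}"
  proof -
    have "{v \<in> topspace (subtopology (mtop R) (fst d)). snd d v \<in> {y. (0, y) \<in> W}} = {v \<in> fst d. (0, snd d v) \<in> W}"
      using fst_chart_subset_pts[OF R'(1) R(2)] unfolding pts_def by auto
    then show ?thesis
      using * openin_chart_domain[OF R'(1) R(2)] by (simp only: openin_open_subtopology)
  qed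
  define T where "T = {v \<in> V. s v \<in> fst c} \<inter> {v \<in> fst d. (0, snd d v) \<in> W}"
  have T: "openin (mtop R) T" unfolding T_def using T1 T2 by blast
  have bT: "b \<in> T" unfolding T_def using V c b W by auto
  have sT: "s v \<in> fst c \<inter> boundary M \<and> ?\<pi> (s v) = v \<and> (0, snd d v) \<in> W \<and> snd c (s v) = G (0, snd d v)"
    if "v \<in> T" for v
    using that sPV[of v] PVB \<pi>\<Phi>[of 1 v] Gt[OF I0, of v] unfolding T_def s_def by auto
  have "openin euclidean {t \<in> topspace euclidean. \<Phi> (cis t, b) \<in> fst c}"
  proof (rule openin_continuous_map_preimage[OF _ openin_chart_domain[OF M c(1)]])
    have "continuous_map euclidean (top_of_set S1) cis"
      by (auto intro!: continuous_map_into_subtopology continuous_intros simp: continuous_map_iff_continuous2)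
    then have "continuous_map euclidean (mtop M) (\<Phi> \<circ> (\<lambda>t. (cis t, b)))"
      using VR V(2) by (intro continuous_map_compose[OF _ cont] continuous_map_pairedI) auto
    then show "continuous_map euclidean (mtop M) (\<lambda>t. \<Phi> (cis t, b))" by (simp add: comp_def)
  qed
  then have J1: "open {t. \<Phi> (cis t, b) \<in> fst c}" by simp
  have J2: "open ((\<lambda>t. (t, snd d b)) -` W)" by (intro open_vimage W continuous_intros)
  define J where "J = ?I \<inter> {t. \<Phi> (cis t, b) \<in> fst c} \<inter> (\<lambda>t. (t, snd d b)) -` W"
  have J: "open J" unfolding J_def by (intro open_Int J1 J2 open_greaterThanLessThan)
  have J0: "0 \<in> J" unfolding J_def using c W by (simp add: s_def)
  have GJ: "G (t, snd d b) = snd c (\<Phi> (cis t, b))" if "t \<in> J" for t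
    using Gt[of t b] that b V(2) unfolding J_def by auto
  have aJ: "a (cis t) (s b) \<in> fst c \<inter> boundary M \<and> ?\<pi> (a (cis t) (s b)) = b \<and> snd c (a (cis t) (s b)) = G (t, snd d b)"
    if "t \<in> J" for t
    using that \<Phi>PV[OF S1 V(2), of t] PVB \<pi>\<Phi>[OF S1 V(2), of t] GJ[OF that]
    unfolding acis[OF V(2)] J_def by auto
  let ?X = "frechet_derivative G (at (0, snd d b)) (1, 0)"
  let ?\<Psi> = "inv_into (S1 \<times> V) \<Phi>"
  let ?h = "snd c1 \<circ> ?\<Psi> \<circ> cinv c2"
  let ?D = "snd c2 ` {q \<in> fst c2. ?\<Psi> q \<in> fst c1}"
  have Jmem: "\<Phi> (cis t, b) \<in> {q \<in> fst c2. ?\<Psi> q \<in> fst c1}" if "t \<in> J" for t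
    using that \<Phi>PV[OF S1 V(2), of t] PVB inv[OF S1 V(2), of t] b V(2) unfolding c1_def c2_def J_def by auto
  \<comment> \<open>Along the orbit through \<open>s b\<close>, \<open>?h\<close> undoes
    \<open>G\<close>. Hence a derivative \<open>D\<close> of \<open>?h\<close> maps
    \<open>?X\<close> to (1, 0), which excludes \<open>?X = 0\<close>.\<close>
  have hG: "?h (G (t, snd d b)) = (t, snd d b)" if t: "t \<in> J" for t
  proof -
    have "cinv c2 (snd c (\<Phi> (cis t, b))) = \<Phi> (cis t, b)"
    proof -
      have "cinv c2 (snd c (\<Phi> (cis t, b))) = cinv c (snd c (\<Phi> (cis t, b)))"
        unfolding c2_def by (rule cinv_subset_chart[OF M c(1)]) (use Jmem[OF t] in \<open>auto simp: c2_def\<close>)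
      also have "\<dots> = \<Phi> (cis t, b)" by (rule cinv_chart[OF M c(1)]) (use Jmem[OF t] in \<open>auto simp: c2_def\<close>)
      finally show ?thesis .
    qed
    then show ?thesis using GJ[OF t] inv[OF S1 V(2), of t] c1t[of t b] t unfolding J_def by simp
  qed
  have GD: "G (t, snd d b) \<in> ?D" if "t \<in> J" for t
    using Jmem[OF that] GJ[OF that] unfolding c2_def by (metis (no_types, lifting) imageI snd_conv)
  have "smooth_on ?D ?h" using smi c1 c2 unfolding smooth_map_def by blast
  from smooth_on_has_derivative[OF this GD[OF J0]] obtain D
    where D: "(?h has_derivative D) (at (G (0, snd d b)) within ?D)" by blast
  have dG: "(G has_derivative frechet_derivative G (at (0, snd d b))) (at (0, snd d b))"
    using Ck_on_has_derivative[OF G W(2)] .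
  have "((\<lambda>t. (t, snd d b)) has_derivative (\<lambda>h. (h, 0))) (at 0 within J)"
    by (auto intro!: derivative_eq_intros)
  from has_derivative_compose[OF this dG]
  have d1: "((\<lambda>t. G (t, snd d b)) has_derivative (\<lambda>h. frechet_derivative G (at (0, snd d b)) (h, 0))) (at 0 within J)" .
  have "(\<lambda>t. G (t, snd d b)) ` J \<subseteq> ?D" using GD by blast
  from has_derivative_in_compose[OF d1 has_derivative_subset[OF D this]]
  have "((\<lambda>t. ?h (G (t, snd d b))) has_derivative
      (\<lambda>h. D (frechet_derivative G (at (0, snd d b)) (h, 0)))) (at 0 within J)" .
  then have "((\<lambda>t. (t, snd d b)) has_derivative
      (\<lambda>h. D (frechet_derivative G (at (0, snd d b)) (h, 0)))) (at 0 within J)"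
    by (rule has_derivative_transform[rotated 2]) (use hG J0 in auto)
  moreover have "((\<lambda>t. (t, snd d b)) has_derivative (\<lambda>h. (h, 0))) (at 0 within J)"
    by (auto intro!: derivative_eq_intros)
  ultimately have "(\<lambda>h. D (frechet_derivative G (at (0, snd d b)) (h, 0))) = (\<lambda>h. (h, 0))"
    unfolding at_within_open[OF J0 J] by (rule has_derivative_unique)
  then have "D ?X = (1, 0)" by meson
  moreover have "D 0 = 0" using D has_derivative_linear linear_0 by blast
  ultimately have "?X \<noteq> 0" by (auto simp: zero_prod_def)
  with that[OF c(1) W(1) G T bT _ sT J J0 aJ] show thesis unfolding T_def by blast
qed

section \<open>Two-forms in coordinates\<close>

text \<open>In coordinates, pullback along \<sigma> commutes with the exterior derivative:
  \<open>J e\<close> is the partial derivative of \<sigma> along e, \<open>H e\<close> the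
  derivative of \<open>J e\<close>, and \<open>C b b'\<close> are the coefficients of a form closed
  at \<open>\<sigma> y\<close>. In the alternating sum of the product rule, the terms with
  \<open>H\<close> cancel by symmetry of \<open>H\<close> and antisymmetry of \<open>C\<close>; the
  terms with \<open>DC\<close> give the exterior derivative of the original form on the vectors
  \<open>J e y\<close>.\<close>

lemma pullback_form_closed:
  fixes \<sigma> :: "'f::real_normed_vector \<Rightarrow> 'e::real_inner" and C :: "'e \<Rightarrow> 'e \<Rightarrow> 'e \<Rightarrow> real"
    and J :: "'f \<Rightarrow> 'f \<Rightarrow> 'e"
  assumes \<sigma>: "(\<sigma> has_derivative L) (at y within T)" "\<sigma> ` T \<subseteq> S"
    and J: "\<And>e. e \<in> E \<Longrightarrow> (J e has_derivative H e) (at y within T)"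
    and sym: "\<And>e e'. e \<in> E \<Longrightarrow> e' \<in> E \<Longrightarrow> H e e' = H e' e"
    and L: "\<And>e. e \<in> E \<Longrightarrow> L e = J e y"
    and span: "\<And>e. e \<in> E \<Longrightarrow> (\<Sum>b\<in>B. (J e y \<bullet> b) *\<^sub>R b) = J e y"
    and C: "\<And>b b'. b \<in> B \<Longrightarrow> b' \<in> B \<Longrightarrow> (C b b' has_derivative DC b b') (at (\<sigma> y) within S)"
    and anti: "\<And>b b'. b \<in> B \<Longrightarrow> b' \<in> B \<Longrightarrow> C b' b (\<sigma> y) = - C b b' (\<sigma> y)"
    and closed: "\<And>b1 b2 b3. b1 \<in> B \<Longrightarrow> b2 \<in> B \<Longrightarrow> b3 \<in> B \<Longrightarrow>
      DC b2 b3 b1 - DC b1 b3 b2 + DC b1 b2 b3 = 0"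
  shows "\<exists>F. (\<forall>e1\<in>E. \<forall>e2\<in>E. ((\<lambda>x. \<Sum>b\<in>B. \<Sum>b'\<in>B. (J e1 x \<bullet> b) * (J e2 x \<bullet> b') * C b b' (\<sigma> x))
        has_derivative F e1 e2) (at y within T)) \<and>
      (\<forall>e1\<in>E. \<forall>e2\<in>E. \<forall>e3\<in>E. F e2 e3 e1 - F e1 e3 e2 + F e1 e2 e3 = 0)"
proof -
  define \<omega> where "\<omega> u v = (\<Sum>b\<in>B. \<Sum>b'\<in>B. (u \<bullet> b) * (v \<bullet> b') * C b b' (\<sigma> y))" for u v
  define \<omega>' where "\<omega>' u v w = (\<Sum>b\<in>B. \<Sum>b'\<in>B. (u \<bullet> b) * (v \<bullet> b') * DC b b' w)" for u v w
  define F where "F e1 e2 h = \<omega> (H e1 h) (J e2 y) + \<omega> (J e1 y) (H e2 h) + \<omega>' (J e1 y) (J e2 y) (L h)" for e1 e2 h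
  have swap: "\<omega> v u = - \<omega> u v" for u v
  proof -
    have "\<omega> v u = (\<Sum>b\<in>B. \<Sum>b'\<in>B. - ((v \<bullet> b) * (u \<bullet> b') * C b' b (\<sigma> y)))"
      unfolding \<omega>_def
    proof (intro sum.cong refl)
      fix b b' assume "b \<in> B" "b' \<in> B"
      then have "C b b' (\<sigma> y) = - C b' b (\<sigma> y)" by (intro anti)
      then show "(v \<bullet> b) * (u \<bullet> b') * C b b' (\<sigma> y) = - ((v \<bullet> b) * (u \<bullet> b') * C b' b (\<sigma> y))" by simp
    qed
    also have "\<dots> = - \<omega> u v"
      unfolding \<omega>_def by (subst sum.swap) (simp add: sum_negf mult.commute mult.left_commute)
    finally show ?thesis .
  qed
  have DC_sum: "DC b b' (J e y) = (\<Sum>b''\<in>B. (J e y \<bullet> b'') * DC b b' b'')" if "b \<in> B" "b' \<in> B" "e \<in> E" for b b' e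
  proof -
    have lin: "linear (DC b b')" using C[OF that(1,2)] has_derivative_linear by blast
    have "DC b b' (J e y) = DC b b' (\<Sum>b''\<in>B. (J e y \<bullet> b'') *\<^sub>R b'')" using span[OF that(3)] by simp
    also have "\<dots> = (\<Sum>b''\<in>B. (J e y \<bullet> b'') * DC b b' b'')"
      by (subst linear_sum[OF lin]) (simp add: linear_cmul[OF lin])
    finally show ?thesis .
  qed
  have expand: "\<omega>' (J e1 y) (J e2 y) (J e3 y) =
      (\<Sum>b1\<in>B. \<Sum>b2\<in>B. \<Sum>b3\<in>B. (J e1 y \<bullet> b1) * (J e2 y \<bullet> b2) * (J e3 y \<bullet> b3) * DC b1 b2 b3)"
    if "e3 \<in> E" for e1 e2 e3
    unfolding \<omega>'_def by (intro sum.cong refl) (simp add: DC_sum[OF _ _ that] sum_distrib_left mult.assoc)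
  \<comment> \<open>Expanded in B and reindexed, the three terms are triple sums with the same
    weight \<open>?w b1 b2 b3\<close>, so closedness annihilates each summand.\<close>
  have cyc: "\<omega>' (J e2 y) (J e3 y) (J e1 y) - \<omega>' (J e1 y) (J e3 y) (J e2 y) + \<omega>' (J e1 y) (J e2 y) (J e3 y) = 0"
    if e: "e1 \<in> E" "e2 \<in> E" "e3 \<in> E" for e1 e2 e3
  proof -
    let ?w = "\<lambda>b1 b2 b3. (J e1 y \<bullet> b1) * (J e2 y \<bullet> b2) * (J e3 y \<bullet> b3)"
    have 1: "\<omega>' (J e2 y) (J e3 y) (J e1 y) = (\<Sum>b1\<in>B. \<Sum>b2\<in>B. \<Sum>b3\<in>B. ?w b1 b2 b3 * DC b2 b3 b1)"
    proof -
      have "\<omega>' (J e2 y) (J e3 y) (J e1 y) = (\<Sum>b2\<in>B. \<Sum>b3\<in>B. \<Sum>b1\<in>B. ?w b1 b2 b3 * DC b2 b3 b1)"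
        unfolding expand[OF e(1)] by (intro sum.cong refl) (simp add: mult_ac)
      also have "\<dots> = (\<Sum>b2\<in>B. \<Sum>b1\<in>B. \<Sum>b3\<in>B. ?w b1 b2 b3 * DC b2 b3 b1)"
        by (intro sum.cong refl sum.swap)
      also have "\<dots> = (\<Sum>b1\<in>B. \<Sum>b2\<in>B. \<Sum>b3\<in>B. ?w b1 b2 b3 * DC b2 b3 b1)"
        by (rule sum.swap)
      finally show ?thesis .
    qed
    have 2: "\<omega>' (J e1 y) (J e3 y) (J e2 y) = (\<Sum>b1\<in>B. \<Sum>b2\<in>B. \<Sum>b3\<in>B. ?w b1 b2 b3 * DC b1 b3 b2)"
    proof -
      have "\<omega>' (J e1 y) (J e3 y) (J e2 y) = (\<Sum>b1\<in>B. \<Sum>b3\<in>B. \<Sum>b2\<in>B. ?w b1 b2 b3 * DC b1 b3 b2)"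
        unfolding expand[OF e(2)] by (intro sum.cong refl) (simp add: mult_ac)
      also have "\<dots> = (\<Sum>b1\<in>B. \<Sum>b2\<in>B. \<Sum>b3\<in>B. ?w b1 b2 b3 * DC b1 b3 b2)"
        by (intro sum.cong refl sum.swap)
      finally show ?thesis .
    qed
    have "\<omega>' (J e2 y) (J e3 y) (J e1 y) - \<omega>' (J e1 y) (J e3 y) (J e2 y) + \<omega>' (J e1 y) (J e2 y) (J e3 y)
        = (\<Sum>b1\<in>B. \<Sum>b2\<in>B. \<Sum>b3\<in>B. ?w b1 b2 b3 * (DC b2 b3 b1 - DC b1 b3 b2 + DC b1 b2 b3))"
      unfolding 1 2 expand[OF e(3)] by (simp add: sum_subtractf sum.distrib distrib_left right_diff_distrib)
    also have "\<dots> = 0" using closed by (intro sum.neutral ballI) simp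
    finally show ?thesis .
  qed
  have "((\<lambda>x. \<Sum>b\<in>B. \<Sum>b'\<in>B. (J e1 x \<bullet> b) * (J e2 x \<bullet> b') * C b b' (\<sigma> x))
      has_derivative F e1 e2) (at y within T)" if e: "e1 \<in> E" "e2 \<in> E" for e1 e2
  proof -
    have "((\<lambda>x. (J e1 x \<bullet> b) * (J e2 x \<bullet> b') * C b b' (\<sigma> x)) has_derivative
        (\<lambda>h. (H e1 h \<bullet> b) * (J e2 y \<bullet> b') * C b b' (\<sigma> y) + (J e1 y \<bullet> b) * (H e2 h \<bullet> b') * C b b' (\<sigma> y)
          + (J e1 y \<bullet> b) * (J e2 y \<bullet> b') * DC b b' (L h))) (at y within T)" if b: "b \<in> B" "b' \<in> B" for b b'
    proof -
      have "((\<lambda>x. C b b' (\<sigma> x)) has_derivative (\<lambda>h. DC b b' (L h))) (at y within T)"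
        by (rule has_derivative_in_compose[OF \<sigma>(1) has_derivative_subset[OF C[OF b] \<sigma>(2)]])
      from has_derivative_mult[OF has_derivative_mult[OF has_derivative_inner_left[OF J[OF e(1)]]
          has_derivative_inner_left[OF J[OF e(2)]]] this]
      show ?thesis by (rule has_derivative_eq_rhs) (simp add: fun_eq_iff algebra_simps)
    qed
    then have "((\<lambda>x. \<Sum>b\<in>B. \<Sum>b'\<in>B. (J e1 x \<bullet> b) * (J e2 x \<bullet> b') * C b b' (\<sigma> x)) has_derivative
        (\<lambda>h. \<Sum>b\<in>B. \<Sum>b'\<in>B. (H e1 h \<bullet> b) * (J e2 y \<bullet> b') * C b b' (\<sigma> y) + (J e1 y \<bullet> b) * (H e2 h \<bullet> b') * C b b' (\<sigma> y)
          + (J e1 y \<bullet> b) * (J e2 y \<bullet> b') * DC b b' (L h))) (at y within T)"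
      by (intro has_derivative_sum)
    then show ?thesis
      by (rule has_derivative_eq_rhs) (simp add: fun_eq_iff F_def \<omega>_def \<omega>'_def sum.distrib)
  qed
  \<comment> \<open>Six terms contain second derivatives. Two pairs cancel by symmetry of
    \<open>H\<close> alone; the pair \<open>\<omega> (J e2 y) (H e3 e1)\<close> and
    \<open>\<omega> (H e1 e3) (J e2 y)\<close> also takes antisymmetry of \<omega>.\<close>
  moreover have "F e2 e3 e1 - F e1 e3 e2 + F e1 e2 e3 = 0"
    if e: "e1 \<in> E" "e2 \<in> E" "e3 \<in> E" for e1 e2 e3
    using cyc[OF e] sym[OF e(2,1)] sym[OF e(3,1)] sym[OF e(3,2)] L[OF e(1)] L[OF e(2)] L[OF e(3)]
      swap[of "J e2 y" "H e1 e3"] swap[of "J e3 y" "H e1 e2"] swap[of "J e1 y" "H e2 e3"]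
    unfolding F_def by simp
  ultimately show ?thesis by blast
qed

section \<open>Bilinear algebra of the coefficients\<close>

lemma coeff_antisym:
  assumes M: "manifold M" "c \<in> atlas M" and \<omega>: "two_form M \<omega>" and y: "y \<in> snd c ` fst c"
    and uv: "u \<in> model M" "v \<in> model M"
  shows "coeff M \<omega> c v u y = - coeff M \<omega> c u v y"
proof -
  obtain p where p: "p \<in> fst c" "y = snd c p" using y by blast
  have "p \<in> pts M" using fst_chart_subset_pts[OF M] p by blast
  then show ?thesis
    using \<omega> coord_vec_in_tangent[OF M p(1)] uv unfolding p(2) coeff_chart[OF M p(1)] two_form_def by blast
qed

lemma coeff_linear:
  assumes M: "manifold M" "c \<in> atlas M" and \<omega>: "two_form M \<omega>" and y: "y \<in> snd c ` fst c"
    and uvw: "u \<in> model M" "v \<in> model M" "w \<in> model M"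
  shows "coeff M \<omega> c (r *\<^sub>R u + s *\<^sub>R v) w y = r * coeff M \<omega> c u w y + s * coeff M \<omega> c v w y"
proof -
  obtain p where p: "p \<in> fst c" "y = snd c p" using y by blast
  have "p \<in> pts M" using fst_chart_subset_pts[OF M] p by blast
  then show ?thesis
    using \<omega> coord_vec_in_tangent[OF M p(1)] uvw
    unfolding p(2) coeff_chart[OF M p(1)] coord_vec_linear[OF M p(1)] two_form_def by blast
qed

lemma coeff_sum:
  assumes M: "manifold M" "c \<in> atlas M" and \<omega>: "two_form M \<omega>" and y: "y \<in> snd c ` fst c"
    and B: "finite B" "B \<subseteq> model M" and w: "w \<in> model M"
  shows "coeff M \<omega> c (\<Sum>b\<in>B. r b *\<^sub>R b) w y = (\<Sum>b\<in>B. r b * coeff M \<omega> c b w y)"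
  using B
proof (induction B rule: finite_induct)
  case empty
  have "0 \<in> model M" using subspace_model[OF M(1)] subspace_0 by blast
  then show ?case using coeff_linear[OF M \<omega> y, of 0 0 w 0 0] w by simp
next
  case (insert b B)
  have "(\<Sum>b\<in>B. r b *\<^sub>R b) \<in> model M"
    using insert.prems subspace_model[OF M(1)] by (intro subspace_sum subspace_scale) auto
  then show ?case
    using coeff_linear[OF M \<omega> y, of b "\<Sum>b\<in>B. r b *\<^sub>R b" w "r b" 1] insert w by simp
qed

lemma coeff_expand:
  assumes M: "manifold M" "c \<in> atlas M" and \<omega>: "two_form M \<omega>" and y: "y \<in> snd c ` fst c"
    and B: "finite B" "B \<subseteq> model M" and u: "u \<in> model M" "(\<Sum>b\<in>B. (u \<bullet> b) *\<^sub>R b) = u"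
    and v: "v \<in> model M" "(\<Sum>b\<in>B. (v \<bullet> b) *\<^sub>R b) = v"
  shows "coeff M \<omega> c u v y = (\<Sum>b\<in>B. \<Sum>b'\<in>B. (u \<bullet> b) * (v \<bullet> b') * coeff M \<omega> c b b' y)"
proof -
  have "coeff M \<omega> c u v y = (\<Sum>b\<in>B. (u \<bullet> b) * coeff M \<omega> c b v y)"
    using coeff_sum[OF M \<omega> y B v(1), of "\<lambda>b. u \<bullet> b"] u(2) by simp
  also have "\<dots> = (\<Sum>b\<in>B. (u \<bullet> b) * (\<Sum>b'\<in>B. (v \<bullet> b') * coeff M \<omega> c b b' y))"
  proof (intro sum.cong refl)
    fix b assume "b \<in> B"
    then have b: "b \<in> model M" using B by blast
    \<comment> \<open>\<open>coeff_sum\<close> expands the first argument; antisymmetry moves v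
      there and, after the expansion, moves each basis vector back.\<close>
    have "coeff M \<omega> c b v y = - coeff M \<omega> c v b y" by (rule coeff_antisym[OF M \<omega> y v(1) b])
    also have "\<dots> = - (\<Sum>b'\<in>B. (v \<bullet> b') * coeff M \<omega> c b' b y)"
      using coeff_sum[OF M \<omega> y B b, of "\<lambda>b. v \<bullet> b"] v(2) by simp
    also have "\<dots> = (\<Sum>b'\<in>B. (v \<bullet> b') * coeff M \<omega> c b b' y)"
    proof -
      have "coeff M \<omega> c b' b y = - coeff M \<omega> c b b' y" if "b' \<in> B" for b'
        using that B by (intro coeff_antisym[OF M \<omega> y b]) auto
      then show ?thesis by (simp add: sum_negf)
    qed
    finally show "(u \<bullet> b) * coeff M \<omega> c b v y = (u \<bullet> b) * (\<Sum>b'\<in>B. (v \<bullet> b') * coeff M \<omega> c b b' y)" by simp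
  qed
  finally show ?thesis by (simp add: sum_distrib_left mult.assoc)
qed

text \<open>Every tangent vector at p is the coordinate vector of a model vector, so testing against
  the model is testing against the whole tangent space.\<close>

lemma coeff_nondegenerate:
  assumes M: "manifold M" "c \<in> atlas M" and \<omega>: "nondegenerate M \<omega>" and p: "p \<in> fst c"
    and w: "w \<in> model M" and zero: "\<And>x. x \<in> model M \<Longrightarrow> coeff M \<omega> c w x (snd c p) = 0"
  shows "w = 0"
proof -
  have pM: "p \<in> pts M" using fst_chart_subset_pts[OF M] p by blast
  have "\<omega> p (coord_vec M c p w) v = 0" if v: "v \<in> tangent M p" for v
    using zero[OF tangent_eq_coord_vec(1)[OF M(2) p v]] tangent_eq_coord_vec(2)[OF M(2) p v]
    unfolding coeff_chart[OF M p] by simp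
  then have "coord_vec M c p w = (\<lambda>_. 0)"
    using \<omega> pM coord_vec_in_tangent[OF M p w] unfolding nondegenerate_def by blast
  then show ?thesis using coord_vec_apply[OF M p w] by simp
qed

section \<open>Reduction\<close>

lemma manifold_boundary_chart:
  assumes "manifold M" "c \<in> atlas M"
  shows "manifold (boundary_mfd M)" "boundary_chart M c \<in> atlas (boundary_mfd M)"
  using assms manifold_boundary_mfd by (auto simp: boundary_mfd_simps)

lemma reduced_mfdD:
  assumes "reduced_mfd M a R"
  shows "manifold R" "smooth_map (boundary_mfd M) R (circle_orbit a)"
  using assms unfolding reduced_mfd_def principal_circle_bundle_def by blast+

section \<open>Derivatives of sections and orbits\<close>

text \<open>Differentiating \<pi>(s v) = v makes the derivative of the projection a left inverse of
  \<open>L\<close>, so \<open>L e\<close> is a lift of e. It is tangent to the boundary because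
  \<sigma> takes values in the model of the boundary.\<close>

lemma section_derivative:
  assumes M: "manifold M" "c \<in> atlas M" and R: "reduced_mfd M a R" "d \<in> atlas R"
    and T: "openin (mtop R) T" "T \<subseteq> fst d" "v \<in> T"
    and s: "\<And>v. v \<in> T \<Longrightarrow> s v \<in> fst c \<inter> boundary M \<and> circle_orbit a (s v) = v \<and> snd c (s v) = \<sigma> (snd d v)"
    and \<sigma>: "(\<sigma> has_derivative L) (at (snd d v) within snd d ` T)" and e: "e \<in> model R"
  shows "L e \<in> model (boundary_mfd M)"
    and "chart_deriv (boundary_chart M c) d (circle_orbit a) (s v) (L e) = e"
proof -
  let ?\<pi> = "circle_orbit a" and ?c = "boundary_chart M c"
  note B = manifold_boundary_chart[OF M] and R' = reduced_mfdD[OF R(1)]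
  have S: "openin (top_of_set {x \<in> model R. 0 \<le> x \<bullet> normal R}) (snd d ` T)"
    using openin_chart_image[OF R'(1) R(2) T(1,2)] unfolding half_model_def .
  have im: "\<sigma> ` snd d ` T \<subseteq> snd ?c ` {q \<in> fst ?c. ?\<pi> q \<in> fst d}"
  proof safe
    fix u assume u: "u \<in> T"
    then have "s u \<in> {q \<in> fst ?c. ?\<pi> q \<in> fst d}" "\<sigma> (snd d u) = snd ?c (s u)" using s[OF u] T(2) by auto
    then show "\<sigma> (snd d u) \<in> snd ?c ` {q \<in> fst ?c. ?\<pi> q \<in> fst d}" by (metis (no_types, lifting) imageI)
  qed
  have "\<sigma> ` snd d ` T \<subseteq> model (boundary_mfd M)"
  proof (rule order_trans[OF im], rule image_subsetI)
    fix q assume "q \<in> {q \<in> fst ?c. ?\<pi> q \<in> fst d}"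
    then show "snd ?c q \<in> model (boundary_mfd M)" by (intro chart_in_model[OF B]) simp
  qed
  then show "L e \<in> model (boundary_mfd M)"
    using half_space_derivative_in_subspace[OF subspace_model[OF R'(1)] S _ \<sigma> subspace_model[OF B(1)] _ e] T(3)
    by blast
  have p: "s v \<in> fst ?c" "?\<pi> (s v) \<in> fst d" "\<sigma> (snd d v) = snd ?c (s v)" using s[OF T(3)] T by auto
  have "((snd d \<circ> ?\<pi> \<circ> cinv ?c) has_derivative chart_deriv ?c d ?\<pi> (s v))
      (at (\<sigma> (snd d v)) within \<sigma> ` snd d ` T)"
    unfolding p(3) using im has_derivative_subset[OF chart_deriv_has_derivative[OF B(2) R(2) R'(2) p(1,2)]] by blast
  from has_derivative_in_compose[OF \<sigma> this]
  have "((\<lambda>y. (snd d \<circ> ?\<pi> \<circ> cinv ?c) (\<sigma> y)) has_derivative (\<lambda>h. chart_deriv ?c d ?\<pi> (s v) (L h)))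
      (at (snd d v) within snd d ` T)" .
  then have "((\<lambda>y. y) has_derivative (\<lambda>h. chart_deriv ?c d ?\<pi> (s v) (L h))) (at (snd d v) within snd d ` T)"
  proof (rule has_derivative_transform[rotated 2])
    fix y assume "y \<in> snd d ` T"
    then obtain u where u: "u \<in> T" "y = snd d u" by blast
    have "s u \<in> fst ?c" "snd ?c (s u) = \<sigma> y" "?\<pi> (s u) = u" using s[OF u(1)] u(2) by auto
    then show "y = (snd d \<circ> ?\<pi> \<circ> cinv ?c) (\<sigma> y)"
      using cinv_chart[OF B] u(2) by (metis comp_apply)
  qed (use T in blast)
  from half_space_derivative_unique[OF subspace_model[OF R'(1)] S _ this has_derivative_ident e] T(3)
  show "chart_deriv ?c d ?\<pi> (s v) (L e) = e" by blast
qed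

text \<open>The orbit stays in the boundary, so its velocity X is tangent to it; the projection is
  constant along the orbit, so it kills X; and reading the same curve in the other charts identifies
  X with the generator.\<close>

lemma orbit_derivative:
  assumes M: "manifold M" "c \<in> atlas M" and R: "reduced_mfd M a R" "d \<in> atlas R"
    and J: "open J" "0 \<in> J" and b: "b \<in> fst d" and p: "p \<in> fst c" "p \<in> boundary M" "a 1 p = p"
    and \<gamma>: "\<And>t. t \<in> J \<Longrightarrow> a (cis t) p \<in> fst c \<inter> boundary M \<and> circle_orbit a (a (cis t) p) = b \<and>
      snd c (a (cis t) p) = g t"
    and g: "(g has_vector_derivative X) (at 0)"
  shows "X \<in> model (boundary_mfd M)"
    and "chart_deriv (boundary_chart M c) d (circle_orbit a) p X = 0"
    and "generator (boundary_mfd M) a p = coord_vec (boundary_mfd M) (boundary_chart M c) p X"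
proof -
  let ?\<pi> = "circle_orbit a" and ?c = "boundary_chart M c" and ?B = "boundary_mfd M"
  note B = manifold_boundary_chart[OF M] and R' = reduced_mfdD[OF R(1)]
  have p': "p \<in> fst ?c" using p by simp
  have g0: "g 0 = snd ?c p" using \<gamma>[OF J(2)] p by simp
  have \<gamma>c: "a (cis t) p \<in> fst ?c" "snd ?c (a (cis t) p) = g t" "cinv ?c (g t) = a (cis t) p" if "t \<in> J" for t
  proof -
    show *: "a (cis t) p \<in> fst ?c" "snd ?c (a (cis t) p) = g t" using \<gamma>[OF that] by auto
    show "cinv ?c (g t) = a (cis t) p" using cinv_chart[OF B *(1)] *(2) by simp
  qed
  have gd: "(g has_derivative (\<lambda>h. h *\<^sub>R X)) (at 0 within J')" for J'
    using g unfolding has_vector_derivative_def by (rule has_derivative_at_withinI)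
  \<comment> \<open>The half-space of normal 0 in the line is the whole line, so the half-space
    lemma also applies to the curve \<open>g\<close>.\<close>
  have "openin (top_of_set {x \<in> UNIV. 0 \<le> x \<bullet> (0::real)}) J" using J by simp
  moreover have "g ` J \<subseteq> model ?B"
  proof safe
    fix t assume "t \<in> J" then show "g t \<in> model ?B" using \<gamma>c chart_in_model[OF B] by metis
  qed
  ultimately have "1 *\<^sub>R X \<in> model ?B"
    using half_space_derivative_in_subspace[OF subspace_UNIV _ J(2) gd subspace_model[OF B(1)], of 0 1] by blast
  then show "X \<in> model ?B" by simp
  \<comment> \<open>Stated for a general target: it is applied to the projection to \<open>R\<close>
    and to the identity of the boundary read in an arbitrary chart.\<close>
  have deriv: "((\<lambda>t. snd d' (f (a (cis t) p))) has_vector_derivative chart_deriv ?c d' f p X) (at 0)"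
    if N: "manifold N" "d' \<in> atlas N" and f: "smooth_map ?B N f" "f p \<in> fst d'"
    for N :: "('n, 'g::euclidean_space) mfd" and d' f
  proof -
    let ?Q = "{q \<in> fst ?c. f q \<in> fst d'}"
    obtain W where W: "open W" "snd ?c ` ?Q = half_model ?B \<inter> W"
      using openin_chart_image[OF B openin_overlap[OF B N f(1)]] by (auto simp: openin_open)
    have "isCont g 0" using g has_vector_derivative_continuous by blast
    moreover have "g 0 \<in> W" unfolding g0 using W(2) p' f(2) by blast
    ultimately have "\<forall>\<^sub>F t in nhds 0. g t \<in> W"
      using W(1) unfolding isCont_def by (metis eventually_nhds_conv_at topological_tendstoD)
    then obtain J1 where J1: "open J1" "0 \<in> J1" "\<And>t. t \<in> J1 \<Longrightarrow> g t \<in> W"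
      unfolding eventually_nhds by blast
    let ?J = "J \<inter> J1"
    have mem: "g t \<in> snd ?c ` ?Q" if "t \<in> ?J" for t
    proof -
      have "g t \<in> snd ?c ` fst ?c" using that \<gamma>c(1,2)[of t] by (metis IntD1 imageI)
      then have "g t \<in> half_model ?B" using chart_image_subset[OF B] by (rule subsetD[rotated])
      then show ?thesis unfolding W(2) using J1(3) that by simp
    qed
    have J': "open ?J" "0 \<in> ?J" using J J1 by auto
    have der: "((snd d' \<circ> f \<circ> cinv ?c) has_derivative chart_deriv ?c d' f p) (at (g 0) within g ` ?J)"
      unfolding g0 using mem by (intro has_derivative_subset[OF chart_deriv_has_derivative[OF B(2) N(2) f(1) p' f(2)]]) blast
    have "((\<lambda>t. (snd d' \<circ> f \<circ> cinv ?c) (g t)) has_derivative (\<lambda>h. chart_deriv ?c d' f p (h *\<^sub>R X))) (at 0 within ?J)"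
      by (rule has_derivative_in_compose[OF gd der])
    then have "((\<lambda>t. snd d' (f (a (cis t) p))) has_derivative (\<lambda>h. chart_deriv ?c d' f p (h *\<^sub>R X))) (at 0 within ?J)"
      by (rule has_derivative_transform[rotated 2]) (use J' \<gamma>c(3) in auto)
    then show ?thesis
      unfolding at_within_open[OF J'(2,1)] has_vector_derivative_def
      by (simp add: linear_cmul[OF linear_chart_deriv[OF B(2) N(2) f(1) p' f(2)]])
  qed
  have \<pi>p: "?\<pi> p = b" using \<gamma>[OF J(2)] p(3) by simp
  have d1: "((\<lambda>t. snd d (?\<pi> (a (cis t) p))) has_vector_derivative chart_deriv ?c d ?\<pi> p X) (at 0)"
    by (rule deriv[OF R'(1) R(2) R'(2)]) (use \<pi>p b in simp)
  have "((\<lambda>t. snd d b) has_vector_derivative chart_deriv ?c d ?\<pi> p X) (at 0)"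
    by (rule has_vector_derivative_transform_within_open[OF d1 J]) (use \<gamma> in simp)
  then show "chart_deriv ?c d ?\<pi> p X = 0"
    using vector_derivative_unique_at has_vector_derivative_const by blast
  show "generator ?B a p = coord_vec ?B ?c p X"
  proof
    fix c' show "generator ?B a p c' = coord_vec ?B ?c p X c'"
    proof (cases "c' \<in> charts_at ?B p")
      case True
      then have "((\<lambda>t. snd c' (id (a (cis t) p))) has_vector_derivative chart_deriv ?c c' id p X) (at 0)"
        by (intro deriv[OF B(1) _ smooth_map_id[OF B(1)]]) (auto simp: charts_at_def)
      then show ?thesis using True vector_derivative_at by (simp add: generator_def coord_vec_def)
    qed (simp add: generator_def coord_vec_def)
  qed
qed

text \<open>Orthogonality of X to K, obtained by reading in \<open>c\<close> that the contraction of
  the pulled-back form with the generator vanishes.\<close>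

lemma coeff_generator:
  assumes M: "manifold M" "c \<in> atlas M" and basic: "basic_on_boundary M a \<beta>"
    and p: "p \<in> fst c" "p \<in> boundary M" and X: "X \<in> model (boundary_mfd M)"
    and gen: "generator (boundary_mfd M) a p = coord_vec (boundary_mfd M) (boundary_chart M c) p X"
    and k: "k \<in> model (boundary_mfd M)"
  shows "coeff M \<beta> c X k (snd c p) = 0"
proof -
  note B = manifold_boundary_chart[OF M]
  have p': "p \<in> fst (boundary_chart M c)" "p \<in> pts (boundary_mfd M)" using p by (auto simp: pts_boundary_mfd)
  have "pullback (boundary_mfd M) M id \<beta> p (generator (boundary_mfd M) a p)
      (coord_vec (boundary_mfd M) (boundary_chart M c) p k) = 0"
    using basic coord_vec_in_tangent[OF B p'(1) k] p'(2) unfolding basic_on_boundary_def basic_form_def by blast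
  then show ?thesis
    using pullback_coord_vec[OF B M smooth_map_boundary_inclusion[OF M(1)] p'(1) _ X k]
      chart_deriv_boundary_inclusion[OF M p] X k p(1) gen by simp
qed

section \<open>Nondegeneracy of the reduced form\<close>

lemma reduced_form_nondegenerate:
  fixes M :: "('m, 'e::euclidean_space) mfd" and R :: "('m set, 'f::euclidean_space) mfd"
  assumes M: "manifold M" and act: "\<And>x. x \<in> boundary M \<Longrightarrow> a 1 x = x" and R: "reduced_mfd M a R"
    and \<beta>: "two_form M \<beta>" "nondegenerate M \<beta>" and basic: "basic_on_boundary M a \<beta>"
    and red: "reduced_form M a R \<beta> \<beta>R"
  shows "nondegenerate R \<beta>R"
  unfolding nondegenerate_def
proof (intro ballI impI)
  fix b u assume b: "b \<in> pts R" and u: "u \<in> tangent R b" and zero: "\<forall>v\<in>tangent R b. \<beta>R b u v = 0"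
  note R' = reduced_mfdD[OF R]
  obtain d where d: "d \<in> atlas R" "b \<in> fst d" using chart_exists[OF R'(1) b] by blast
  obtain c s W J T and G :: "real \<times> 'f \<Rightarrow> 'e" where c: "c \<in> atlas M" and W: "open W" "\<And>k. Ck_on k W G"
    and T: "openin (mtop R) T" "b \<in> T" "T \<subseteq> fst d"
    and s: "\<And>v. v \<in> T \<Longrightarrow> s v \<in> fst c \<inter> boundary M \<and> circle_orbit a (s v) = v \<and>
      (0, snd d v) \<in> W \<and> snd c (s v) = G (0, snd d v)"
    and J: "open J" "0 \<in> J"
    and \<gamma>: "\<And>t. t \<in> J \<Longrightarrow> a (cis t) (s b) \<in> fst c \<inter> boundary M \<and> circle_orbit a (a (cis t) (s b)) = b \<and>
      snd c (a (cis t) (s b)) = G (t, snd d b)"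
    and X0: "frechet_derivative G (at (0, snd d b)) (1, 0) \<noteq> 0"
    by (rule local_trivialization[OF M R d], rule that)
  let ?n = "normal M" and ?K = "model (boundary_mfd M)"
  define p where "p = s b"
  define D where "D = frechet_derivative G (at (0, snd d b))"
  define X where "X = D (1, 0)"
  define Q where "Q = chart_deriv (boundary_chart M c) d (circle_orbit a) p"
  define \<omega> where "\<omega> x y = coeff M \<beta> c x y (snd c p)" for x y
  note B = manifold_boundary_chart[OF M c]
  have p: "p \<in> fst c" "p \<in> boundary M" "circle_orbit a p = b" using s[OF T(2)] unfolding p_def by auto
  have DG: "(G has_derivative D) (at (0, snd d b))"
    unfolding D_def by (rule Ck_on_has_derivative[OF W(2)]) (use s[OF T(2)] in blast)
  have linD: "linear D" using DG has_derivative_linear by blast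
  have "((\<lambda>t. (t, snd d b)) has_derivative (\<lambda>h. (h, 0))) (at 0)"
    by (auto intro!: derivative_eq_intros)
  from has_derivative_compose[OF this DG] have "((\<lambda>t. G (t, snd d b)) has_derivative (\<lambda>h. D (h, 0))) (at 0)" .
  moreover have "D (h, 0) = h *\<^sub>R X" for h unfolding X_def using linear_cmul[OF linD, of h "(1, 0)"] by simp
  ultimately have g: "((\<lambda>t. G (t, snd d b)) has_vector_derivative X) (at 0)" by (simp add: has_vector_derivative_def)
  note orb = orbit_derivative[OF M c R d(1) J d(2) p(1,2) act[OF p(2)] \<gamma>[folded p_def] g]
  have XK: "X \<in> ?K" and QX: "Q X = 0" using orb(1,2) unfolding Q_def by auto
  have \<omega>X: "\<omega> X k = 0" if "k \<in> ?K" for k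
    unfolding \<omega>_def by (rule coeff_generator[OF M c basic p(1,2) XK orb(3) that])
  define e where "e = u d"
  have e: "e \<in> model R" "u = coord_vec R d b e"
    using tangent_eq_coord_vec[OF d u] unfolding e_def by auto
  have "((\<lambda>y. (0, y)) has_derivative (\<lambda>h. (0, h))) (at (snd d b) within snd d ` T)"
    by (auto intro!: derivative_eq_intros)
  from has_derivative_compose[OF this DG]
  have \<sigma>: "((\<lambda>y. G (0, y)) has_derivative (\<lambda>h. D (0, h))) (at (snd d b) within snd d ` T)" .
  have s': "s v \<in> fst c \<inter> boundary M \<and> circle_orbit a (s v) = v \<and> snd c (s v) = G (0, snd d v)" if "v \<in> T" for v
    using s[OF that] by blast
  \<comment> \<open>The lift of u through the section, which is the slice of angle 0: hence the zero
    first component.\<close>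
  define w where "w = D (0, e)"
  have wK: "w \<in> ?K" and Qw: "Q w = e"
    using section_derivative[OF M c R d(1) T(1,3,2) s' \<sigma> e(1)] unfolding w_def Q_def p_def by auto
  have linQ: "linear Q"
    unfolding Q_def by (rule linear_chart_deriv[OF B(2) d(1) R'(2)]) (use p d in auto)
  \<comment> \<open>Pairing w with a boundary vector k is pairing u with the projection
    \<open>Q k\<close>, and u lies in the kernel of \<open>\<beta>R\<close>.\<close>
  have \<omega>w: "\<omega> w k = 0" if k: "k \<in> ?K" for k
  proof -
    have "\<omega> w k = coeff R \<beta>R d (Q w) (Q k) (snd d b)"
      using reduced_form_coeff[OF M c R d(1) red p(1,2) _ wK k] p(3) d(2) unfolding \<omega>_def Q_def by simp
    also have "\<dots> = \<beta>R b u (coord_vec R d b (Q k))"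
      using coeff_chart[OF R'(1) d] e(2) Qw by simp
    also have "\<dots> = 0"
    proof -
      have "Q k \<in> model R"
        unfolding Q_def by (rule chart_deriv_in_model[OF B R'(1) d(1) R'(2) _ _ k]) (use p d in auto)
      then show ?thesis using zero coord_vec_in_tangent[OF R'(1) d] by blast
    qed
    finally show ?thesis .
  qed
  have nM: "?n \<in> model M" using M unfolding manifold_def by blast
  have n0: "?n \<noteq> 0" using p(2) unfolding boundary_def by auto
  have KM: "?K = {x \<in> model M. x \<bullet> ?n = 0}" by (simp add: boundary_mfd_simps)
  note sub = subspace_model[OF M]
  have lin: "\<omega> (r *\<^sub>R x + t *\<^sub>R y) z = r * \<omega> x z + t * \<omega> y z"
    if "x \<in> model M" "y \<in> model M" "z \<in> model M" for x y z r t
    unfolding \<omega>_def by (rule coeff_linear[OF M c \<beta>(1) _ that]) (use p in blast)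
  have anti: "\<omega> y x = - \<omega> x y" if "x \<in> model M" "y \<in> model M" for x y
    unfolding \<omega>_def by (rule coeff_antisym[OF M c \<beta>(1) _ that]) (use p in blast)
  \<comment> \<open>The model is the sum of K and the line through the normal; \<open>r\<close>
    below is the coefficient of the orthogonal projection onto that line.\<close>
  have zeroI: "x = 0" if x: "x \<in> model M" "\<And>k. k \<in> ?K \<Longrightarrow> \<omega> x k = 0" "\<omega> x ?n = 0" for x
  proof (rule coeff_nondegenerate[OF M c \<beta>(2) p(1) x(1)])
    fix y assume y: "y \<in> model M"
    define r where "r = (y \<bullet> ?n) / (?n \<bullet> ?n)"
    have k: "y - r *\<^sub>R ?n \<in> ?K"
      unfolding KM using y nM n0 sub by (simp add: subspace_diff subspace_scale inner_diff_left r_def)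
    then have "\<omega> (1 *\<^sub>R (y - r *\<^sub>R ?n) + r *\<^sub>R ?n) x = 1 * \<omega> (y - r *\<^sub>R ?n) x + r * \<omega> ?n x"
      using x(1) nM unfolding KM by (intro lin) auto
    moreover have "\<omega> (y - r *\<^sub>R ?n) x = 0" "\<omega> ?n x = 0"
      using anti[OF x(1)] k nM x(2)[OF k] x(3) unfolding KM by auto
    ultimately have "\<omega> y x = 0" by simp
    then show "coeff M \<beta> c x y (snd c p) = 0" using anti[OF x(1) y] unfolding \<omega>_def by simp
  qed
  have XM: "X \<in> model M" and wM: "w \<in> model M" using XK wK unfolding KM by auto
  have Xn: "\<omega> X ?n \<noteq> 0" using zeroI[OF XM \<omega>X] X0 unfolding X_def D_def by blast
  define x where "x = \<omega> X ?n *\<^sub>R w + (- \<omega> w ?n) *\<^sub>R X"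
  have "x = 0"
  proof (rule zeroI)
    show "x \<in> model M" unfolding x_def using XM wM sub by (intro subspace_add subspace_scale)
    show "\<omega> x ?n = 0" unfolding x_def lin[OF wM XM nM] by simp
    fix k assume k: "k \<in> ?K"
    then have kM: "k \<in> model M" unfolding KM by simp
    show "\<omega> x k = 0" unfolding x_def lin[OF wM XM kM] using \<omega>X[OF k] \<omega>w[OF k] by simp
  qed
  \<comment> \<open>Rather than solving x = 0 for w, the relation is projected: X disappears and a
    nonzero multiple of e remains.\<close>
  moreover have "Q x = \<omega> X ?n *\<^sub>R e"
    unfolding x_def using Qw QX by (simp add: linear_add[OF linQ] linear_diff[OF linQ] linear_cmul[OF linQ])
  ultimately have "e = 0" using Xn linear_0[OF linQ] by simp
  then show "u = (\<lambda>_. 0)"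
    using e(2) coord_vec_linear[OF R'(1) d, of 0 0 0 0] by simp
qed

section \<open>Closedness of the reduced form\<close>

lemma reduced_form_closed:
  fixes M :: "('m, 'e::euclidean_space) mfd" and R :: "('m set, 'f::euclidean_space) mfd"
  assumes M: "manifold M" and R: "reduced_mfd M a R"
    and \<beta>: "two_form M \<beta>" "closed_form M \<beta>"
    and red: "reduced_form M a R \<beta> \<beta>R"
  shows "closed_form R \<beta>R"
  unfolding closed_form_def
proof (intro ballI)
  fix d y e1 e2 e3 assume d: "d \<in> atlas R" and "y \<in> snd d ` fst d"
    and e: "e1 \<in> model R" "e2 \<in> model R" "e3 \<in> model R"
  then obtain b where b: "b \<in> fst d" "y = snd d b" by blast
  note R' = reduced_mfdD[OF R]
  obtain c s W J T and G :: "real \<times> 'f \<Rightarrow> 'e" where c: "c \<in> atlas M" and W: "open W" "\<And>k. Ck_on k W G"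
    and T: "openin (mtop R) T" "b \<in> T" "T \<subseteq> fst d"
    and s: "\<And>v. v \<in> T \<Longrightarrow> s v \<in> fst c \<inter> boundary M \<and> circle_orbit a (s v) = v \<and>
      (0, snd d v) \<in> W \<and> snd c (s v) = G (0, snd d v)"
    using local_trivialization[OF M R d b(1)] by metis
  let ?T = "snd d ` T" and ?S = "snd c ` fst c"
  define \<sigma> where "\<sigma> x = G (0, x)" for x
  define D where "D x = frechet_derivative G (at (0, x))" for x
  define J where "J e x = D x (0, e)" for e x
  \<comment> \<open>A second derivative of \<open>G\<close> in the ambient product space, evaluated
    only on directions with zero angle component.\<close>
  define H where "H e h = frechet_derivative (\<lambda>z. frechet_derivative G (at z) (0, e)) (at (0, y)) (0, h)" for e h
  have W0: "(0, x) \<in> W" if "x \<in> ?T" for x using s that by blast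
  have emb: "((\<lambda>x. (0, x)) has_derivative (\<lambda>h. (0, h))) (at x within ?T)" for x :: 'f
    by (auto intro!: derivative_eq_intros)
  have \<sigma>: "(\<sigma> has_derivative (\<lambda>h. J h x)) (at x within ?T)" if "x \<in> ?T" for x
    unfolding \<sigma>_def J_def D_def
    by (rule has_derivative_compose[OF emb Ck_on_has_derivative[OF W(2) W0[OF that]]])
  have s': "s v \<in> fst c \<inter> boundary M \<and> circle_orbit a (s v) = v \<and> snd c (s v) = \<sigma> (snd d v)" if "v \<in> T" for v
    using s[OF that] unfolding \<sigma>_def by blast
  have \<sigma>T: "\<sigma> ` ?T \<subseteq> ?S"
  proof safe
    fix v assume "v \<in> T" then show "\<sigma> (snd d v) \<in> ?S" using s'[of v] by (metis IntE imageI)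
  qed
  have JK: "J e (snd d v) \<in> model (boundary_mfd M)"
    "chart_deriv (boundary_chart M c) d (circle_orbit a) (s v) (J e (snd d v)) = e"
    if "v \<in> T" "e \<in> model R" for v e
    using section_derivative[OF M c R d T(1,3) that(1) s' \<sigma> that(2)] that(1) by blast+
  have JM: "J e x \<in> model M" if "x \<in> ?T" "e \<in> model R" for e x
    using JK(1) that by (auto simp: boundary_mfd_simps)
  have yT: "y \<in> ?T" using b T by blast
  have Jd: "(J e has_derivative H e) (at y within ?T)" for e
  proof -
    have "Ck_on (Suc 0) W (\<lambda>z. frechet_derivative G (at z) (0, e))" using W(2)[of "Suc (Suc 0)"] by simp
    from has_derivative_compose[OF emb Ck_on_has_derivative[OF this W0[OF yT]]]
    show ?thesis unfolding J_def D_def H_def .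
  qed
  have sym: "H e e' = H e' e" for e e'
    unfolding H_def by (rule symmetric_second_derivative[OF W(1) W0[OF yT] W(2)])
  \<comment> \<open>The derivatives of \<beta> are known for coefficients with fixed vectors, but
    \<open>J e x\<close> moves with x. Expansion in an orthonormal basis separates the two into
    inner products and finitely many functions \<open>C b b'\<close>.\<close>
  obtain B where B: "B \<subseteq> model M" "pairwise orthogonal B" "\<And>x. x \<in> B \<Longrightarrow> norm x = 1"
    "independent B" "span B = model M"
    using orthonormal_basis_subspace[OF subspace_model[OF M]] by metis
  have finB: "finite B" using B(4) independent_imp_finite by blast
  have expand: "(\<Sum>b\<in>B. (x \<bullet> b) *\<^sub>R b) = x" if "x \<in> model M" for x
    by (rule orthonormal_basis_expand[OF B(2,3) _ finB]) (use that B(5) in auto)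
  define C where "C u v = coeff M \<beta> c u v" for u v
  define DC where "DC u v = frechet_derivative (C u v) (at (\<sigma> y) within ?S)" for u v
  have C: "(C u v has_derivative DC u v) (at (\<sigma> y) within ?S)" if "u \<in> B" "v \<in> B" for u v
    unfolding C_def DC_def
  proof (rule smooth_on_has_derivative)
    show "smooth_on ?S (coeff M \<beta> c u v)"
      using \<beta>(1)[unfolded two_form_def, THEN conjunct2, rule_format, OF c] that B(1) by blast
    show "\<sigma> y \<in> ?S" using \<sigma>T yT by blast
  qed
  have anti: "C v u (\<sigma> y) = - C u v (\<sigma> y)" if "u \<in> B" "v \<in> B" for u v
    unfolding C_def by (rule coeff_antisym[OF M c \<beta>(1)]) (use that B(1) \<sigma>T yT in auto)
  have closed: "DC b2 b3 b1 - DC b1 b3 b2 + DC b1 b2 b3 = 0" if "b1 \<in> B" "b2 \<in> B" "b3 \<in> B" for b1 b2 b3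
  proof -
    have "\<sigma> y \<in> ?S" using \<sigma>T yT by blast
    moreover have "b1 \<in> model M" "b2 \<in> model M" "b3 \<in> model M" using that B(1) by auto
    ultimately have "ext_deriv M \<beta> c (\<sigma> y) b1 b2 b3 = 0"
      using \<beta>(2) c unfolding closed_form_def by blast
    then show ?thesis unfolding ext_deriv_def DC_def C_def .
  qed
  have Jexp: "(\<Sum>b\<in>B. (J e y \<bullet> b) *\<^sub>R b) = J e y" if "e \<in> model R" for e
    by (rule expand[OF JM[OF yT that]])
  obtain F where F: "\<And>e1 e2. e1 \<in> model R \<Longrightarrow> e2 \<in> model R \<Longrightarrow>
      ((\<lambda>x. \<Sum>b\<in>B. \<Sum>b'\<in>B. (J e1 x \<bullet> b) * (J e2 x \<bullet> b') * C b b' (\<sigma> x)) has_derivative F e1 e2) (at y within ?T)"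
    and F0: "F e2 e3 e1 - F e1 e3 e2 + F e1 e2 e3 = 0"
    using pullback_form_closed[where E = "model R" and J = J,
        OF \<sigma>[OF yT] \<sigma>T Jd sym refl Jexp C anti closed] e by blast
  \<comment> \<open>On \<open>?T\<close> the reduced form is the pullback of \<beta> along \<sigma>,
    since \<open>J e x\<close> is a lift of e at the point of the section over x.\<close>
  have "coeff R \<beta>R d e1 e2 x = (\<Sum>b\<in>B. \<Sum>b'\<in>B. (J e1 x \<bullet> b) * (J e2 x \<bullet> b') * C b b' (\<sigma> x))"
    if e: "e1 \<in> model R" "e2 \<in> model R" and x: "x \<in> ?T" for e1 e2 x
  proof -
    obtain v where v: "v \<in> T" "x = snd d v" using x by blast
    have p: "s v \<in> fst c" "s v \<in> boundary M" "circle_orbit a (s v) = v" "snd c (s v) = \<sigma> x"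
      using s'[OF v(1)] v(2) by auto
    have "coeff R \<beta>R d e1 e2 x = C (J e1 x) (J e2 x) (\<sigma> x)"
      using reduced_form_coeff[OF M c R d red p(1,2) _ JK(1)[OF v(1) e(1)] JK(1)[OF v(1) e(2)]]
        JK(2)[OF v(1) e(1)] JK(2)[OF v(1) e(2)] p v T(3) unfolding C_def by auto
    also have "\<dots> = (\<Sum>b\<in>B. \<Sum>b'\<in>B. (J e1 x \<bullet> b) * (J e2 x \<bullet> b') * C b b' (\<sigma> x))"
      unfolding C_def
      by (rule coeff_expand[OF M c \<beta>(1) _ finB B(1) JM[OF x e(1)] expand[OF JM[OF x e(1)]]
            JM[OF x e(2)] expand[OF JM[OF x e(2)]]]) (use \<sigma>T x in blast)
    finally show ?thesis .
  qed
  then have dT: "(coeff R \<beta>R d e1 e2 has_derivative F e1 e2) (at y within ?T)"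
    if "e1 \<in> model R" "e2 \<in> model R" for e1 e2
    using has_derivative_transform[OF yT _ F[OF that]] that by blast
  \<comment> \<open>\<open>ext_deriv\<close> differentiates within the whole chart image, whereas
    the pullback formula holds on \<open>?T\<close>; uniqueness on the half-space identifies the two
    derivatives on the model.\<close>
  have "frechet_derivative (coeff R \<beta>R d e1 e2) (at y within snd d ` fst d) h = F e1 e2 h"
    if e: "e1 \<in> model R" "e2 \<in> model R" "h \<in> model R" for e1 e2 h
  proof (rule half_space_derivative_unique[OF subspace_model[OF R'(1)] _ yT _ dT[OF e(1,2)] e(3)])
    show "openin (top_of_set {x \<in> model R. 0 \<le> x \<bullet> normal R}) ?T"
      using openin_chart_image[OF R'(1) d T(1,3)] unfolding half_model_def .
    have "smooth_on (snd d ` fst d) (coeff R \<beta>R d e1 e2)"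
      using red d e unfolding reduced_form_def two_form_def by blast
    from smooth_on_has_derivative[OF this] b(1,2)
    have "(coeff R \<beta>R d e1 e2 has_derivative frechet_derivative (coeff R \<beta>R d e1 e2) (at y within snd d ` fst d))
        (at y within snd d ` fst d)" by blast
    then show "(coeff R \<beta>R d e1 e2 has_derivative frechet_derivative (coeff R \<beta>R d e1 e2) (at y within snd d ` fst d))
        (at y within ?T)"
      by (rule has_derivative_subset) (use T(3) in blast)
  qed
  then show "ext_deriv R \<beta>R d y e1 e2 e3 = 0" using F0 e unfolding ext_deriv_def by simp
qed

theorem lemma10p2:
  fixes M :: "('m, 'e::euclidean_space) mfd"
    and U :: "'m set"
    and a :: "complex \<Rightarrow> 'm \<Rightarrow> 'm"
    and R :: "('m set, 'f::euclidean_space) mfd"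
    and \<beta> :: "('m, 'e) form2"
    and \<beta>R :: "('m set, 'f) form2"
  assumes "manifold M"
    and "free_circle_action_near_boundary M U a"
    and "reduced_mfd M a R"
    and "symplectic_form M \<beta>"
    and "basic_on_boundary M a \<beta>"
    and "invariant_near_boundary M U a \<beta>"
    and "reduced_form M a R \<beta> \<beta>R"
  shows "symplectic_form R \<beta>R"
proof -
  have act: "free_circle_action (open_submfd M U) a"
    using assms(2) unfolding free_circle_action_near_boundary_def by simp
  \<comment> \<open>The orbit curve has to start at the given boundary point. Boundary points lie in
    \<open>U\<close>, where the unit law of the action holds.\<close>
  have "a 1 x = x" if "x \<in> boundary M" for x
  proof -
    have "x \<in> pts (open_submfd M U)"
      using assms(2) that unfolding free_circle_action_near_boundary_def
      by (auto simp: pts_def open_submfd_def boundary_def)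
    then show ?thesis
      using act unfolding free_circle_action_def by simp
  qed
  then have "nondegenerate R \<beta>R"
    using reduced_form_nondegenerate assms unfolding symplectic_form_def by blast
  moreover have "closed_form R \<beta>R"
    using reduced_form_closed assms unfolding symplectic_form_def by blast
  ultimately show ?thesis
    using assms(7) unfolding symplectic_form_def reduced_form_def by blast
qed

end
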